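(* Let $G$ be an infinite weighted graph with a fixed vertex $o$ and exponential upper growth $g_0<\infty$, and let $g=\max(g_0,1)$. Then the random walk $\{X_k\}$ on $G$ started at $o$ satisfies $$\limsup_{k\to\infty}\frac{|X_k|}{k}\ \le\ \frac{g-1}{g+1}\qquad\text{almost surely.}$$
   Context: A weighted graph $G=(V,w)$ is a set $V$ of vertices with a symmetric function $w:V\times V\to[0,\infty)$; the edges are the pairs on which $w$ is positive. Write $w_x=\sum_y w(x,y)$ (with $0<w_x<\infty$); the random walk on $G$ moves from $x$ to $y$ with probability $w(x,y)/w_x$. $|v|$ denotes the graph distance between $v$ and $o$. $w_n$ denotes the total weight of the edges at distance $n$ from $o$, and the exponential upper growth of $G$ is $\limsup_{n\to\infty} w_n^{1/n}$. *)

theory Defs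
  imports "HOL-Probability.Probability"
begin

text \<open>The vertex set is the type \<open>'v\<close>. A pair with \<open>w x x > 0\<close> is a loop; loops are allowed.\<close>

definition vweight :: "('v \<Rightarrow> 'v \<Rightarrow> real) \<Rightarrow> 'v \<Rightarrow> real" where
  "vweight w x = (\<Sum>\<^sub>\<infinity>y. w x y)"

text \<open>Summability expresses that the vertex weight is finite; the default value of
  \<^const>\<open>infsum\<close> would hide divergence.\<close>

definition weighted_graph :: "('v \<Rightarrow> 'v \<Rightarrow> real) \<Rightarrow> bool" where
  "weighted_graph w \<longleftrightarrow>
     (\<forall>x y. w x y = w y x) \<and> (\<forall>x y. 0 \<le> w x y) \<and>
     (\<forall>x. w x summable_on UNIV \<and> 0 < vweight w x)"

definition adj :: "('v \<Rightarrow> 'v \<Rightarrow> real) \<Rightarrow> ('v \<times> 'v) set" where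
  "adj w = {(x, y). 0 < w x y}"

text \<open>The distance is infinite between different connected components.\<close>

definition gdist :: "('v \<Rightarrow> 'v \<Rightarrow> real) \<Rightarrow> 'v \<Rightarrow> 'v \<Rightarrow> enat" where
  "gdist w x y = (INF n\<in>{n. (x, y) \<in> adj w ^^ n}. enat n)"

text \<open>Edges are undirected, so that each edge contributes once to a total weight.
  The distance of an edge from \<open>r\<close> is that of its endpoint nearer to \<open>r\<close>; edges joining
  two vertices at the same distance count as well.\<close>

definition edges_at :: "('v \<Rightarrow> 'v \<Rightarrow> real) \<Rightarrow> 'v \<Rightarrow> nat \<Rightarrow> 'v set set" where
  "edges_at w r n = {{x, y} |x y. 0 < w x y \<and> min (gdist w r x) (gdist w r y) = enat n}"

definition edge_weight :: "('v \<Rightarrow> 'v \<Rightarrow> real) \<Rightarrow> 'v set \<Rightarrow> real" where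
  "edge_weight w e = (THE a. \<exists>x y. e = {x, y} \<and> a = w x y)"

lemma edge_weight_eq:
  assumes "weighted_graph w"
  shows "edge_weight w {x, y} = w x y"
  unfolding edge_weight_def using assms
  by (intro the_equality) (auto simp: weighted_graph_def doubleton_eq_iff)

text \<open>The graph need not be locally finite, so the total weight at a given distance may be infinite.\<close>

definition level_weight :: "('v \<Rightarrow> 'v \<Rightarrow> real) \<Rightarrow> 'v \<Rightarrow> nat \<Rightarrow> ennreal" where
  "level_weight w r n = (\<Sum>\<^sub>\<infinity>e\<in>edges_at w r n. ennreal (edge_weight w e))"

definition ennroot :: "nat \<Rightarrow> ennreal \<Rightarrow> ennreal" where
  "ennroot n a = (if a = \<infinity> then \<infinity> else ennreal (root n (enn2real a)))"

definition upper_growth :: "('v \<Rightarrow> 'v \<Rightarrow> real) \<Rightarrow> 'v \<Rightarrow> ennreal" where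
  "upper_growth w r = limsup (\<lambda>n. ennroot n (level_weight w r n))"

text \<open>Any process on any probability space whose finite-dimensional distributions are those of the
  Markov chain started at \<open>r\<close>; the last clause is the Markov property, multiplied
  out to avoid conditioning on null events.\<close>

definition random_walk ::
    "('v \<Rightarrow> 'v \<Rightarrow> real) \<Rightarrow> 'v \<Rightarrow> 'a measure \<Rightarrow> (nat \<Rightarrow> 'a \<Rightarrow> 'v) \<Rightarrow> bool" where
  "random_walk w r M X \<longleftrightarrow>
     prob_space M \<and>
     (\<forall>k. X k \<in> measurable M (count_space UNIV)) \<and>
     (AE \<omega> in M. X 0 \<omega> = r) \<and>
     (\<forall>n x. measure M {\<omega> \<in> space M. \<forall>i\<le>Suc n. X i \<omega> = x i} =
        measure M {\<omega> \<in> space M. \<forall>i\<le>n. X i \<omega> = x i} * (w (x n) (x (Suc n)) / vweight w (x n)))"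

end

theory Submission
  imports Defs
begin

text \<open>Let \<open>T\<close> be the time at which the walk first reaches distance \<open>m + 1\<close> from the root \<open>r\<close>. For \<open>g < c\<close>
the edges at distance \<open>m\<close> have total weight at most \<open>c ^ m\<close> when \<open>m\<close> is large, and the claim is that
then \<open>T\<close> is smaller than \<open>q * m\<close>, for any fixed \<open>q < (c + 1) / (c - 1)\<close>, only with a probability that is
exponentially small in \<open>m\<close>. By Borel--Cantelli the speed is at most \<open>(c - 1) / (c + 1)\<close>, and \<open>c\<close> may
tend to \<open>g\<close>.

To bound the probability that \<open>T\<close> is small, kill the walk with probability \<open>1 - exp (-t)\<close> per step and let
\<open>\<epsilon>\<close> be the probability that it reaches its target alive, which is the Laplace transform of \<open>T\<close> at
\<open>t\<close>. Condition on this event and let \<open>N\<close> be the conditional expectation of \<open>T\<close>. Nonnegativity of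
relative entropy gives \<open>t * N \<le> - ln \<epsilon>\<close>, so a lower bound on \<open>N\<close> is an upper bound on \<open>\<epsilon>\<close>.

The conditioned walk is again reversible, and its net flow \<open>\<theta>\<close> is the gradient flow of a potential \<open>\<rho>\<close>.
The time spent on an edge is \<open>\<bar>\<theta>\<bar>\<close> times \<open>coth (\<alpha> / 2)\<close>, where \<open>\<alpha>\<close> is the drop of \<open>ln \<rho>\<close> along the
edge. As \<open>coth\<close> is convex, it may be replaced by its tangent at \<open>\<alpha> = ln c\<close> (\<open>sum_vs_difference\<close>). The
sum over all edges then involves only the total flow, which is at least \<open>m\<close> because a unit of flow has
to climb \<open>m\<close> levels, and the total drop of \<open>ln \<rho>\<close> along the flow. This drop is at most
\<open>m * ln c - 2 * ln \<epsilon>\<close> up to a constant, because the flow leaves through edges of total weight at most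
\<open>c ^ m\<close>. Hence \<open>N\<close> is at least \<open>m * (c + 1) / (c - 1)\<close>, up to a constant and a multiple of \<open>- ln \<epsilon>\<close>.
The latter is harmless because it enters the inequality \<open>t * N \<le> - ln \<epsilon>\<close> with the small factor \<open>t\<close>.
This is \<open>positive_network_bound\<close>, the core of the proof.

The argument is carried out on finite networks, where sums can be rearranged freely and the
hitting probabilities and Green functions solve finite linear systems (\<open>hitting_transform_bound\<close>). A
walk on an infinite graph, possibly with infinite degrees, is reduced to this case by its tightness up to
a fixed time and by an optional stopping argument (\<open>prob_in_target_le\<close>).\<close>

section \<open>A convexity inequality for opposite traversals of an edge\<close>

text \<open>With \<open>z = exp \<alpha>\<close> the left-hand side is \<open>coth (\<alpha>/2)\<close>, a convex function of \<open>\<alpha> > 0\<close>; the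
right-hand side is its tangent at \<open>\<alpha> = ln c\<close>.\<close>

lemma coth_tangent:
  fixes z c :: real
  assumes "1 < z" "1 < c"
  shows "(z + 1) / (z - 1) \<ge> (c + 1) / (c - 1) - 2 * c / (c - 1)^2 * (ln z - ln c)"
proof -
  define f where "f = (\<lambda>z::real. (z + 1) / (z - 1) + 2 * c / (c - 1)^2 * ln z)"
  define f' where "f' = (\<lambda>z::real. 2 * (z - c) * (c * z - 1) / (z * (z - 1)^2 * (c - 1)^2))"
  have der: "(f has_real_derivative f' y) (at y)" if "1 < y" for y
  proof -
    have "((\<lambda>z::real. (z + 1) / (z - 1) + B * ln z) has_real_derivative
        ((y - 1) - (y + 1)) / ((y - 1) * (y - 1)) + B * (1 / y)) (at y)" for B
      using that by (auto intro!: derivative_eq_intros)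
    then have "(f has_real_derivative
        ((y - 1) - (y + 1)) / ((y - 1) * (y - 1)) + 2 * c / (c - 1)^2 * (1 / y)) (at y)"
      unfolding f_def .
    moreover have "((y - 1) - (y + 1)) / ((y - 1) * (y - 1)) + 2 * c / (c - 1)^2 * (1 / y) = f' y"
    proof -
      have "-2 * (y * (c - 1)^2) + 2 * c * (y - 1)^2 = 2 * (y - c) * (c * y - 1)"
        by (simp add: power2_eq_square algebra_simps)
      moreover have "((y - 1) - (y + 1)) / ((y - 1) * (y - 1)) + 2 * c / (c - 1)^2 * (1 / y)
          = (-2 * (y * (c - 1)^2) + 2 * c * (y - 1)^2) / (y * (y - 1)^2 * (c - 1)^2)"
        using that assms by (simp add: divide_simps power2_eq_square)
      ultimately show ?thesis unfolding f'_def by simp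
    qed
    ultimately show ?thesis by simp
  qed
  have "f c \<le> f z"
  proof (cases "c \<le> z")
    case True
    show ?thesis
    proof (rule DERIV_nonneg_imp_nondecreasing[OF True])
      fix y assume y: "c \<le> y" "y \<le> z"
      have "1 < c * y" using assms y by (simp add: less_1_mult)
      then have "0 \<le> f' y" unfolding f'_def using y assms
        by (intro divide_nonneg_nonneg mult_nonneg_nonneg) auto
      then show "\<exists>l. (f has_real_derivative l) (at y) \<and> 0 \<le> l" using der[of y] y assms by (intro exI[of _ "f' y"]) auto
    qed
  next
    case False
    then have le: "z \<le> c" by simp
    show ?thesis
    proof (rule DERIV_nonpos_imp_nonincreasing[OF le])
      fix y assume y: "z \<le> y" "y \<le> c"
      have "1 < c * y" using assms y by (simp add: less_1_mult)
      then have "f' y \<le> 0" unfolding f'_def using y assms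
        by (intro divide_nonpos_nonneg mult_nonneg_nonneg mult_nonpos_nonneg mult_nonneg_nonpos) auto
      then show "\<exists>l. (f has_real_derivative l) (at y) \<and> l \<le> 0" using der[of y] y assms by (intro exI[of _ "f' y"]) auto
    qed
  qed
  then show ?thesis unfolding f_def by (simp add: right_diff_distrib)
qed

text \<open>In the application \<open>p\<close> and \<open>q\<close> are proportional to the expected numbers of traversals of an edge
in its two directions, so that \<open>p + q\<close> is the time spent on the edge and \<open>p - q\<close> the net flow
through it. Time is bounded below by the net flow at the price of the drop of the logarithm of a
potential. Applying \<open>coth_tangent\<close> to \<open>p / q\<close> gives the case \<open>q < p\<close>, and both sides are symmetric.\<close>

lemma sum_vs_difference:
  fixes p q c :: real
  assumes "0 < p" "0 < q" "1 < c"
  defines "\<beta> \<equiv> 2 * c / (c - 1)^2"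
  shows "((c + 1) / (c - 1) + \<beta> * ln c) * \<bar>p - q\<bar> - \<beta> * (p - q) * (ln p - ln q) \<le> p + q"
proof -
  have main: "((c + 1) / (c - 1) + \<beta> * ln c) * (p - q) - \<beta> * (p - q) * (ln p - ln q) \<le> p + q"
    if "0 < q" "q < p" for p q :: real
  proof -
    have "1 < p / q" using that by simp
    from coth_tangent[OF this \<open>1 < c\<close>]
    have "(c + 1) / (c - 1) - \<beta> * (ln (p / q) - ln c) \<le> (p / q + 1) / (p / q - 1)"
      by (simp add: \<beta>_def)
    also have "(p / q + 1) / (p / q - 1) = (p + q) / (p - q)"
      using that by (simp add: divide_simps)
    finally have "((c + 1) / (c - 1) - \<beta> * (ln p - ln q - ln c)) * (p - q) \<le> p + q"
      using that by (simp add: pos_le_divide_eq ln_div)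
    then show ?thesis by (simp add: algebra_simps)
  qed
  consider "p = q" | "q < p" | "p < q" by linarith
  then show ?thesis
  proof cases
    case 1 then show ?thesis using assms by simp
  next
    case 2 then show ?thesis using main[of q p] assms by simp
  next
    case 3 then show ?thesis using main[of p q] assms by (simp add: algebra_simps)
  qed
qed

section \<open>A flow bound for killed walks on finite networks\<close>

text \<open>Summation by parts: the net flow \<open>c x y - c y x\<close>, paired with a gradient, equals its divergence
paired with the potential.\<close>

lemma sum_flow_difference:
  fixes c :: "'v \<Rightarrow> 'v \<Rightarrow> real" and F :: "'v \<Rightarrow> real"
  shows "(\<Sum>x\<in>D. \<Sum>y\<in>D. c x y * (F x - F y)) = (\<Sum>x\<in>D. F x * (\<Sum>y\<in>D. c x y - c y x))"
proof -
  have "(\<Sum>x\<in>D. \<Sum>y\<in>D. c x y * F y) = (\<Sum>x\<in>D. \<Sum>y\<in>D. c y x * F x)"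
    by (rule sum.swap)
  then show ?thesis
    by (simp add: right_diff_distrib sum_subtractf sum_distrib_left mult.commute)
qed

text \<open>This is Jensen's inequality for the logarithm of \<open>1 / z\<close> under the probability weights \<open>f\<close>.\<close>

lemma sum_ln_lower_bound:
  fixes f z :: "'v \<Rightarrow> real"
  assumes "finite D" and f: "\<And>x. x \<in> D \<Longrightarrow> 0 \<le> f x" "(\<Sum>x\<in>D. f x) = 1"
    and z: "\<And>x. x \<in> D \<Longrightarrow> 0 < z x" and S: "0 < S" "(\<Sum>x\<in>D. f x / z x) \<le> S"
  shows "- ln S \<le> (\<Sum>x\<in>D. f x * ln (z x))"
proof -
  have "f x * (- ln (z x) - ln S) \<le> f x / z x / S - f x" if "x \<in> D" for x
  proof -
    have "- ln (z x) - ln S = ln (1 / (z x * S))" using z[OF that] S by (simp add: ln_div ln_mult)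
    also have "\<dots> \<le> 1 / (z x * S) - 1" using z[OF that] S by (intro ln_le_minus_one) simp
    finally have "f x * (- ln (z x) - ln S) \<le> f x * (1 / (z x * S) - 1)"
      using f(1)[OF that] by (rule mult_left_mono)
    then show ?thesis by (simp add: algebra_simps)
  qed
  then have "(\<Sum>x\<in>D. f x * (- ln (z x) - ln S)) \<le> (\<Sum>x\<in>D. f x / z x / S - f x)"
    by (rule sum_mono)
  also have "\<dots> = (\<Sum>x\<in>D. f x / z x) / S - 1"
    by (simp add: sum_subtractf sum_divide_distrib f)
  also have "\<dots> \<le> 0" using S by simp
  finally have "- (\<Sum>x\<in>D. f x * ln (z x)) - (\<Sum>x\<in>D. f x * ln S) \<le> 0"
    by (simp add: right_diff_distrib sum_subtractf sum_negf)
  moreover have "(\<Sum>x\<in>D. f x * ln S) = ln S"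
    using f(2) by (simp flip: sum_distrib_right)
  ultimately show ?thesis by linarith
qed

text \<open>Read \<open>\<pi> x\<close> as the full weight of the vertex \<open>x\<close>, \<open>b x\<close> as the weight of its edges into a target,
and let the missing weight be lost to a cemetery. For the walk killed with survival probability
\<open>exp (-t)\<close> per step, \<open>u x\<close> is the probability of reaching the target from \<open>x\<close>, and \<open>v\<close> is the Green
function of the walk started at \<open>r\<close>, divided by \<open>\<pi>\<close>.

Condition the killed walk started at \<open>r\<close> to reach the target. Then \<open>cc x y\<close> below is the expected
number of steps from \<open>x\<close> to \<open>y\<close>, \<open>f x\<close> is the probability that the last step starts at \<open>x\<close>, and
\<open>N\<close> is the expected duration; the conditioned walk is reversible, so its net flow is the gradient
flow of \<open>v / u\<close>. The duration satisfies two inequalities.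

\<^item> The relative entropy of the conditioned walk with respect to the original walk is nonnegative, which
  reads \<open>t * N \<le> - ln (u r)\<close>.

\<^item> Summing \<open>sum_vs_difference\<close> over the edges bounds \<open>N\<close> below by the flux of the potential
  \<open>\<Phi> = K * lev + \<beta> * ln (v / u)\<close>. The first term contributes at least \<open>K * m\<close>, because a unit of
  flow climbs \<open>m\<close> levels. The second is controlled at \<open>r\<close> by \<open>C\<close> and at the exit by Jensen's
  inequality: a flow through edges of total weight at most \<open>W\<close> cannot leave at points where \<open>v / u\<close> is
  very small on average.

Each of the two ends costs a factor \<open>u r\<close> from the normalisation, which is the source of the factor
\<open>1 + 2 * \<beta> * t\<close>.\<close>

lemma positive_network_bound:
  fixes w :: "'v \<Rightarrow> 'v \<Rightarrow> real" and b \<pi> u v lev :: "'v \<Rightarrow> real"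
  assumes fin: "finite D" and r: "r \<in> D"
    and sym: "\<And>x y. w x y = w y x" and w0: "\<And>x y. 0 \<le> w x y"
    and b0: "\<And>x. x \<in> D \<Longrightarrow> 0 \<le> b x"
    and tot: "\<And>x. x \<in> D \<Longrightarrow> (\<Sum>y\<in>D. w x y) + b x \<le> \<pi> x"
    and lip: "\<And>x y. x \<in> D \<Longrightarrow> y \<in> D \<Longrightarrow> 0 < w x y \<Longrightarrow> \<bar>lev x - lev y\<bar> \<le> 1"
    and lev: "lev r = 0" "\<And>x. x \<in> D \<Longrightarrow> 0 < b x \<Longrightarrow> m \<le> lev x"
    and t: "0 < t"
    and u: "\<And>x. x \<in> D \<Longrightarrow> 0 < u x \<and> u x \<le> 1"
      "\<And>x. x \<in> D \<Longrightarrow> \<pi> x * u x = exp (-t) * ((\<Sum>y\<in>D. w x y * u y) + b x)"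
    and v: "\<And>x. x \<in> D \<Longrightarrow> 0 < v x"
      "\<And>x. x \<in> D \<Longrightarrow> \<pi> x * v x = (if x = r then 1 else 0) + exp (-t) * (\<Sum>y\<in>D. w x y * v y)"
    and C: "v r \<le> C" and W: "0 < W" "(\<Sum>x\<in>D. b x) \<le> W" and c: "1 < c"
  defines "\<beta> \<equiv> 2 * c / (c - 1)^2"
  shows "t * (m * ((c + 1) / (c - 1) + \<beta> * ln c) - \<beta> * (ln W + ln C))
    \<le> (1 + 2 * \<beta> * t) * (- ln (u r))"
proof -
  define s where "s = exp (-t)"
  define \<epsilon> where "\<epsilon> = u r"
  define K where "K = (c + 1) / (c - 1) + \<beta> * ln c"
  define n where "n x = \<pi> x * v x * u x / \<epsilon>" for x
  define cc where "cc x y = s * w x y * v x * u y / \<epsilon>" for x y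
  define f where "f x = s * b x * v x / \<epsilon>" for x
  define \<Phi> where "\<Phi> x = K * lev x + \<beta> * (ln (v x) - ln (u x))" for x
  have s: "0 < s" "s < 1" "ln s = - t" using t by (auto simp: s_def)
  have e: "0 < \<epsilon>" using u(1) r by (simp add: \<epsilon>_def)
  have beta: "0 < \<beta>" using c by (simp add: \<beta>_def)
  have K: "0 < K" unfolding K_def using c beta by (intro add_pos_pos divide_pos_pos mult_pos_pos) auto
  have cc_sum: "(\<Sum>y\<in>D. cc x y) = n x - f x" if "x \<in> D" for x
  proof -
    have "(\<Sum>y\<in>D. cc x y) = s * (\<Sum>y\<in>D. w x y * u y) * v x / \<epsilon>"
      by (simp add: cc_def sum_distrib_left sum_distrib_right sum_divide_distrib mult_ac)
    also have "s * (\<Sum>y\<in>D. w x y * u y) = \<pi> x * u x - s * b x"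
      using u(2)[OF that] by (simp add: s_def algebra_simps)
    finally show ?thesis by (simp add: n_def f_def left_diff_distrib right_diff_distrib diff_divide_distrib mult_ac)
  qed
  have cc_sum': "(\<Sum>y\<in>D. cc y x) = n x - (if x = r then 1 else 0)" if "x \<in> D" for x
  proof -
    have "(\<Sum>y\<in>D. cc y x) = s * (\<Sum>y\<in>D. w x y * v y) * u x / \<epsilon>"
      by (simp add: cc_def sum_distrib_left sum_distrib_right sum_divide_distrib mult_ac sym[of _ x])
    also have "s * (\<Sum>y\<in>D. w x y * v y) = \<pi> x * v x - (if x = r then 1 else 0)"
      using v(2)[OF that] by (simp add: s_def algebra_simps)
    finally show ?thesis using e
      by (simp add: n_def left_diff_distrib right_diff_distrib diff_divide_distrib mult_ac \<epsilon>_def)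
  qed
  have div: "(\<Sum>y\<in>D. cc x y - cc y x) = (if x = r then 1 else 0) - f x" if "x \<in> D" for x
    using cc_sum[OF that] cc_sum'[OF that] by (simp add: sum_subtractf)
  have tele: "(\<Sum>x\<in>D. \<Sum>y\<in>D. cc x y * (F x - F y)) = F r - (\<Sum>x\<in>D. F x * f x)" for F
  proof -
    have "(\<Sum>x\<in>D. \<Sum>y\<in>D. cc x y * (F x - F y))
        = (\<Sum>x\<in>D. F x * ((if x = r then 1 else 0) - f x))"
      unfolding sum_flow_difference by (intro sum.cong refl) (simp add: div)
    also have "\<dots> = F r - (\<Sum>x\<in>D. F x * f x)"
    proof -
      have "F x * ((if x = r then 1 else 0) - f x) = (if x = r then F x else 0) - F x * f x" for x
        by (simp add: right_diff_distrib)
      then show ?thesis using fin r by (simp add: sum_subtractf)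
    qed
    finally show ?thesis .
  qed
  have f1: "(\<Sum>x\<in>D. f x) = 1" using tele[of "\<lambda>_. 1"] by simp
  have f0: "0 \<le> f x" if "x \<in> D" for x
    using that b0 v(1) s e by (simp add: f_def less_imp_le)
  have cc0: "0 \<le> cc x y" if "x \<in> D" "y \<in> D" for x y
    unfolding cc_def using that w0[of x y] v(1)[of x] u(1)[of y] s e by (simp add: less_imp_le)
  define N where "N = (\<Sum>x\<in>D. n x)"
  have Neq: "N = (\<Sum>x\<in>D. \<Sum>y\<in>D. cc x y) + 1"
    by (simp add: N_def cc_sum sum_subtractf f1)
  \<comment> \<open>Nonnegativity of the relative entropy, obtained vertex by vertex from \<open>ln z \<le> z - 1\<close>.\<close>
  have kl: "t * N \<le> - ln \<epsilon>"
  proof -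
    have one: "cc x y * (t + ln (u x) - ln (u y)) \<le> w x y * v x * u x / \<epsilon> - cc x y"
      if "x \<in> D" "y \<in> D" for x y
    proof -
      have "t + ln (u x) - ln (u y) = ln (u x / (s * u y))"
        using u(1)[of x] u(1)[of y] that s by (simp add: ln_div ln_mult)
      also have "\<dots> \<le> u x / (s * u y) - 1"
        using u(1)[of x] u(1)[of y] that s by (intro ln_le_minus_one) simp
      finally have "cc x y * (t + ln (u x) - ln (u y)) \<le> cc x y * (u x / (s * u y) - 1)"
        using cc0[OF that] by (rule mult_left_mono)
      also have "cc x y * (u x / (s * u y)) = w x y * v x * u x / \<epsilon>"
        using u(1)[of y] that s by (simp add: cc_def)
      then have "cc x y * (u x / (s * u y) - 1) = w x y * v x * u x / \<epsilon> - cc x y"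
        by (simp add: right_diff_distrib)
      finally show ?thesis .
    qed
    have two: "f x * (t + ln (u x)) \<le> b x * v x * u x / \<epsilon> - f x" if "x \<in> D" for x
    proof -
      have "t + ln (u x) = ln (u x / s)" using u(1)[of x] that s by (simp add: ln_div)
      also have "\<dots> \<le> u x / s - 1" using u(1)[of x] that s by (intro ln_le_minus_one) simp
      finally have "f x * (t + ln (u x)) \<le> f x * (u x / s - 1)"
        using f0[OF that] by (rule mult_left_mono)
      also have "f x * (u x / s - 1) = b x * v x * u x / \<epsilon> - f x"
        using s by (simp add: f_def right_diff_distrib)
      finally show ?thesis .
    qed
    have three: "(\<Sum>y\<in>D. cc x y * (t + ln (u x) - ln (u y))) + f x * (t + ln (u x)) \<le> 0"
      if "x \<in> D" for x
    proof -
      have "(\<Sum>y\<in>D. cc x y * (t + ln (u x) - ln (u y))) + f x * (t + ln (u x))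
          \<le> (\<Sum>y\<in>D. w x y * v x * u x / \<epsilon> - cc x y) + (b x * v x * u x / \<epsilon> - f x)"
        by (intro add_mono sum_mono one two that)
      also have "\<dots> = ((\<Sum>y\<in>D. w x y) + b x) * (v x * u x / \<epsilon>) - n x"
        using cc_sum[OF that]
        by (simp add: sum_subtractf distrib_right sum_distrib_right add_divide_distrib
            sum_divide_distrib mult.assoc)
      also have "\<dots> \<le> \<pi> x * (v x * u x / \<epsilon>) - n x"
        using tot[OF that] v(1)[OF that] u(1)[OF that] e
        by (intro diff_right_mono mult_right_mono) auto
      also have "\<dots> = 0" by (simp add: n_def)
      finally show ?thesis .
    qed
    have "(\<Sum>x\<in>D. (\<Sum>y\<in>D. cc x y * (t + ln (u x) - ln (u y))) + f x * (t + ln (u x))) \<le> 0"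
      by (intro sum_nonpos three)
    moreover have "(\<Sum>x\<in>D. (\<Sum>y\<in>D. cc x y * (t + ln (u x) - ln (u y))) + f x * (t + ln (u x)))
       = t * ((\<Sum>x\<in>D. \<Sum>y\<in>D. cc x y) + (\<Sum>x\<in>D. f x))
         + (\<Sum>x\<in>D. \<Sum>y\<in>D. cc x y * (ln (u x) - ln (u y))) + (\<Sum>x\<in>D. ln (u x) * f x)"
      by (simp add: sum.distrib sum_subtractf sum_distrib_left algebra_simps)
    ultimately show ?thesis using tele[of "\<lambda>x. ln (u x)"] f1 Neq by (simp add: \<epsilon>_def)
  qed
  \<comment> \<open>The flux of \<open>\<Phi>\<close> is at most the expected number of steps before the last one.\<close>
  have geo: "(\<Sum>x\<in>D. \<Phi> x * f x) - \<Phi> r \<le> N - 1"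
  proof -
    have pt: "(cc x y - cc y x) * (\<Phi> y - \<Phi> x) \<le> cc x y + cc y x" if "x \<in> D" "y \<in> D" for x y
    proof (cases "0 < w x y")
      case False
      then have "w x y = 0" using w0[of x y] by simp
      then show ?thesis using sym[of x y] by (simp add: cc_def)
    next
      case True
      define a where "a = s * w x y / \<epsilon>"
      have a: "0 < a" using True s e by (simp add: a_def)
      define p q where "p = v x * u y" and "q = v y * u x"
      have pq: "0 < p" "0 < q" using that u(1) v(1) by (auto simp: p_def q_def)
      have ccs: "cc x y = a * p" "cc y x = a * q"
        by (simp_all add: cc_def a_def p_def q_def sym[of y x])
      have lnpq: "ln p - ln q = (ln (v x) - ln (u x)) - (ln (v y) - ln (u y))"
        using u(1)[of x] u(1)[of y] v(1)[of x] v(1)[of y] that by (simp add: p_def q_def ln_mult)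
      have "(p - q) * (\<Phi> y - \<Phi> x) = K * ((p - q) * (lev y - lev x)) - \<beta> * (p - q) * (ln p - ln q)"
        unfolding lnpq \<Phi>_def by (simp add: algebra_simps)
      also have "(p - q) * (lev y - lev x) \<le> \<bar>p - q\<bar>"
      proof -
        have "\<bar>lev y - lev x\<bar> \<le> 1" using lip[OF that True] by linarith
        then have "\<bar>p - q\<bar> * \<bar>lev y - lev x\<bar> \<le> \<bar>p - q\<bar>"
          by (metis abs_ge_zero mult.right_neutral mult_left_mono)
        then show ?thesis by (metis abs_ge_self abs_mult order_trans)
      qed
      finally have "(p - q) * (\<Phi> y - \<Phi> x) \<le> K * \<bar>p - q\<bar> - \<beta> * (p - q) * (ln p - ln q)"
        using K by (simp add: mult_left_mono)
      also have "\<dots> \<le> p + q"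
        using sum_vs_difference[OF pq c] by (simp add: K_def \<beta>_def)
      finally have "a * ((p - q) * (\<Phi> y - \<Phi> x)) \<le> a * (p + q)"
        using a by (intro mult_left_mono) auto
      then show ?thesis unfolding ccs by (simp add: algebra_simps)
    qed
    have "(\<Sum>x\<in>D. \<Sum>y\<in>D. (cc x y - cc y x) * (\<Phi> y - \<Phi> x)) \<le> (\<Sum>x\<in>D. \<Sum>y\<in>D. cc x y + cc y x)"
      by (intro sum_mono pt)
    moreover have "(\<Sum>x\<in>D. \<Sum>y\<in>D. cc y x) = (\<Sum>x\<in>D. \<Sum>y\<in>D. cc x y)" by (rule sum.swap)
    then have "(\<Sum>x\<in>D. \<Sum>y\<in>D. cc x y + cc y x) = 2 * (\<Sum>x\<in>D. \<Sum>y\<in>D. cc x y)"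
      by (simp add: sum.distrib)
    moreover have swap: "(\<Sum>x\<in>D. \<Sum>y\<in>D. cc y x * (\<Phi> y - \<Phi> x)) = (\<Sum>x\<in>D. \<Sum>y\<in>D. cc x y * (\<Phi> x - \<Phi> y))"
      by (rule sum.swap)
    moreover have "(\<Sum>x\<in>D. \<Sum>y\<in>D. (cc x y - cc y x) * (\<Phi> y - \<Phi> x))
        = - 2 * (\<Sum>x\<in>D. \<Sum>y\<in>D. cc x y * (\<Phi> x - \<Phi> y))"
    proof -
      have "(cc x y - cc y x) * (\<Phi> y - \<Phi> x)
          = - (cc x y * (\<Phi> x - \<Phi> y)) - cc y x * (\<Phi> y - \<Phi> x)" for x y
        by (simp add: algebra_simps)
      then show ?thesis using swap by (simp add: sum_subtractf sum_negf)
    qed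
    ultimately show ?thesis using tele[of \<Phi>] Neq by simp
  qed
  \<comment> \<open>The exit distribution \<open>f\<close> lives at height at least \<open>m\<close>; there \<open>f / (v / u)\<close> has total mass at most \<open>W / \<epsilon>\<close>.\<close>
  have out: "K * m + \<beta> * (- ln (W / \<epsilon>)) \<le> (\<Sum>x\<in>D. \<Phi> x * f x)"
  proof -
    have "(\<Sum>x\<in>D. m * f x) \<le> (\<Sum>x\<in>D. lev x * f x)"
    proof (rule sum_mono)
      fix x assume x: "x \<in> D"
      show "m * f x \<le> lev x * f x"
      proof (cases "0 < b x")
        case True
        then show ?thesis using lev(2)[OF x] f0[OF x] by (simp add: mult_right_mono)
      next
        case False
        then have "b x = 0" using b0[OF x] by simp
        then show ?thesis by (simp add: f_def)
      qed
    qed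
    then have 1: "m \<le> (\<Sum>x\<in>D. lev x * f x)" using f1 by (simp flip: sum_distrib_left)
    have "- ln (W / \<epsilon>) \<le> (\<Sum>x\<in>D. f x * ln (v x / u x))"
    proof (rule sum_ln_lower_bound[OF fin f0 f1])
      show "0 < v x / u x" if "x \<in> D" for x using u(1) v(1) that by simp
      show "0 < W / \<epsilon>" using W e by simp
      have "f x / (v x / u x) \<le> b x / \<epsilon>" if "x \<in> D" for x
      proof -
        have "s * (b x * u x) \<le> 1 * (b x * 1)"
          using s u(1)[OF that] b0[OF that] by (intro mult_mono mult_left_mono) auto
        then have "s * b x * u x / \<epsilon> \<le> b x / \<epsilon>" using e by (simp add: divide_right_mono mult_ac)
        moreover have "f x / (v x / u x) = s * b x * u x / \<epsilon>"
          using v(1)[OF that] by (simp add: f_def field_simps)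
        ultimately show ?thesis by simp
      qed
      then have "(\<Sum>x\<in>D. f x / (v x / u x)) \<le> (\<Sum>x\<in>D. b x / \<epsilon>)" by (rule sum_mono)
      also have "\<dots> \<le> W / \<epsilon>" using W e by (simp add: divide_right_mono flip: sum_divide_distrib)
      finally show "(\<Sum>x\<in>D. f x / (v x / u x)) \<le> W / \<epsilon>" .
    qed
    also have "(\<Sum>x\<in>D. f x * ln (v x / u x)) = (\<Sum>x\<in>D. f x * (ln (v x) - ln (u x)))"
    proof (intro sum.cong refl)
      fix x assume "x \<in> D"
      then show "f x * ln (v x / u x) = f x * (ln (v x) - ln (u x))"
        using u(1)[of x] v(1)[of x] by (simp add: ln_div)
    qed
    finally have 2: "- ln (W / \<epsilon>) \<le> (\<Sum>x\<in>D. f x * (ln (v x) - ln (u x)))" .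
    have "(\<Sum>x\<in>D. \<Phi> x * f x) = K * (\<Sum>x\<in>D. lev x * f x) + \<beta> * (\<Sum>x\<in>D. f x * (ln (v x) - ln (u x)))"
      unfolding \<Phi>_def by (simp add: sum_distrib_left distrib_left distrib_right sum.distrib mult_ac)
    then show ?thesis using 1 2 K beta by (simp only:) (intro add_mono mult_left_mono; simp)
  qed
  have "ln (v r) \<le> ln C" using C v(1)[OF r] by simp
  then have "\<beta> * (ln (v r) - ln \<epsilon>) \<le> \<beta> * (ln C - ln \<epsilon>)" using beta by (intro mult_left_mono) auto
  then have "\<Phi> r \<le> \<beta> * (ln C - ln \<epsilon>)" by (simp add: \<Phi>_def lev \<epsilon>_def)
  moreover have "\<beta> * ln (W / \<epsilon>) = \<beta> * ln W - \<beta> * ln \<epsilon>"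
    using W e by (simp add: ln_div right_diff_distrib)
  ultimately have "K * m - \<beta> * (ln W + ln C) + 2 * \<beta> * ln \<epsilon> \<le> N"
    using geo out by (simp add: algebra_simps)
  then have "t * (K * m - \<beta> * (ln W + ln C) + 2 * \<beta> * ln \<epsilon>) \<le> t * N"
    using t by (intro mult_left_mono) auto
  with kl have "t * (K * m - \<beta> * (ln W + ln C) + 2 * \<beta> * ln \<epsilon>) \<le> - ln \<epsilon>" by linarith
  then show ?thesis unfolding K_def[symmetric] \<epsilon>_def by (simp add: algebra_simps)
qed

text \<open>Monotone iteration from zero stays below the supersolution \<open>f\<close>, and its limit solves the system.
Both the hitting probabilities and the Green function of a killed walk arise in this way.\<close>

lemma nonneg_linear_system_solution:
  fixes a :: "'v \<Rightarrow> 'v \<Rightarrow> real" and h f :: "'v \<Rightarrow> real"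
  assumes a: "\<And>x y. x \<in> D \<Longrightarrow> y \<in> D \<Longrightarrow> 0 \<le> a x y" and h: "\<And>x. x \<in> D \<Longrightarrow> 0 \<le> h x"
    and f: "\<And>x. x \<in> D \<Longrightarrow> 0 \<le> f x" "\<And>x. x \<in> D \<Longrightarrow> h x + (\<Sum>y\<in>D. a x y * f y) \<le> f x"
  shows "\<exists>u. \<forall>x\<in>D. 0 \<le> u x \<and> u x \<le> f x \<and> u x = h x + (\<Sum>y\<in>D. a x y * u y)"
proof -
  define T where "T u x = h x + (\<Sum>y\<in>D. a x y * u y)" for u :: "'v \<Rightarrow> real" and x
  define U where "U n = (T ^^ n) (\<lambda>_. 0)" for n
  have US: "U (Suc n) x = T (U n) x" for n x by (simp add: U_def)
  have mono: "T u x \<le> T u' x" if "x \<in> D" "\<And>y. y \<in> D \<Longrightarrow> u y \<le> u' y" for u u' x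
    unfolding T_def using that a by (intro add_left_mono sum_mono mult_left_mono) auto
  have bd: "0 \<le> U n x \<and> U n x \<le> f x" if "x \<in> D" for n x
    using that
  proof (induction n arbitrary: x)
    case 0
    then show ?case using f by (simp add: U_def)
  next
    case (Suc n)
    have "0 \<le> T (U n) x" unfolding T_def using Suc h a
      by (intro add_nonneg_nonneg sum_nonneg mult_nonneg_nonneg) auto
    moreover have "T (U n) x \<le> T f x" using Suc by (intro mono) auto
    then have "T (U n) x \<le> f x" using f(2)[OF Suc.prems] by (simp add: T_def)
    ultimately show ?case by (simp add: US)
  qed
  have inc: "U n x \<le> U (Suc n) x" if "x \<in> D" for n x
    using that
  proof (induction n arbitrary: x)
    case 0
    then show ?case using bd[of x 1] by (simp add: U_def)
  next
    case (Suc n)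
    then show ?case unfolding US[of "Suc n"] US[of n] by (intro mono) (auto simp: US)
  qed
  define u where "u x = lim (\<lambda>n. U n x)" for x
  have lim: "(\<lambda>n. U n x) \<longlonglongrightarrow> u x" if "x \<in> D" for x
  proof -
    have "incseq (\<lambda>n. U n x)" using inc[OF that] by (rule incseq_SucI)
    then have "convergent (\<lambda>n. U n x)"
      using incseq_convergent[of "\<lambda>n. U n x" "f x"] bd[OF that] unfolding convergent_def by blast
    then show ?thesis unfolding u_def by (simp add: convergent_LIMSEQ_iff)
  qed
  have "u x = T u x" if "x \<in> D" for x
  proof -
    have "(\<lambda>n. T (U n) x) \<longlonglongrightarrow> T u x"
      unfolding T_def by (intro tendsto_intros lim)
    moreover have "(\<lambda>n. T (U n) x) \<longlonglongrightarrow> u x"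
      using LIMSEQ_Suc[OF lim[OF that]] by (simp add: US)
    ultimately show ?thesis by (rule LIMSEQ_unique[symmetric])
  qed
  moreover have "0 \<le> u x" "u x \<le> f x" if "x \<in> D" for x
    using LIMSEQ_le_const[OF lim[OF that], of 0] LIMSEQ_le_const2[OF lim[OF that], of "f x"]
      bd[OF that] by simp_all
  ultimately show ?thesis unfolding T_def by blast
qed

text \<open>The function \<open>u\<close> of \<open>positive_network_bound\<close> is obtained below the supersolution \<open>1\<close>. The Green
function is obtained below the constant \<open>C\<close>: a constant \<open>C\<close> loses at least \<open>(1 - exp (-t)) * \<pi> r * C\<close>
at \<open>r\<close>, which pays for the unit source there. Where \<open>u\<close> or \<open>v\<close> vanishes, no edge leads to a vertex
where both are positive, so the network may be restricted to the vertices of the latter kind; this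
set contains \<open>r\<close> unless \<open>u r = 0\<close>, in which case the bound is trivial.\<close>

lemma hitting_transform_bound:
  fixes w :: "'v \<Rightarrow> 'v \<Rightarrow> real" and b \<pi> lev :: "'v \<Rightarrow> real"
  assumes fin: "finite D" and r: "r \<in> D"
    and sym: "\<And>x y. w x y = w y x" and w0: "\<And>x y. 0 \<le> w x y"
    and b0: "\<And>x. x \<in> D \<Longrightarrow> 0 \<le> b x" and pi0: "\<And>x. x \<in> D \<Longrightarrow> 0 < \<pi> x"
    and tot: "\<And>x. x \<in> D \<Longrightarrow> (\<Sum>y\<in>D. w x y) + b x \<le> \<pi> x"
    and lip: "\<And>x y. x \<in> D \<Longrightarrow> y \<in> D \<Longrightarrow> 0 < w x y \<Longrightarrow> \<bar>lev x - lev y\<bar> \<le> 1"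
    and lev: "lev r = 0" "\<And>x. x \<in> D \<Longrightarrow> 0 < b x \<Longrightarrow> m \<le> lev x"
    and t: "0 < t" and W: "0 < W" "(\<Sum>x\<in>D. b x) \<le> W" and c: "1 < c"
  defines "\<beta> \<equiv> 2 * c / (c - 1)^2" and "C \<equiv> 1 / ((1 - exp (-t)) * \<pi> r)"
  shows "\<exists>u. (\<forall>x\<in>D. 0 \<le> u x \<and> u x \<le> 1 \<and> \<pi> x * u x = exp (-t) * ((\<Sum>y\<in>D. w x y * u y) + b x)) \<and>
    u r \<le> exp (- (t * (m * ((c + 1) / (c - 1) + \<beta> * ln c) - \<beta> * (ln W + ln C)) / (1 + 2 * \<beta> * t)))"
    (is "\<exists>u. _ \<and> u r \<le> exp (- (?A / ?B))")
proof -
  define s where "s = exp (-t)"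
  have s: "0 < s" "s < 1" using t by (auto simp: s_def)
  have C0: "0 < C" unfolding C_def using s pi0[OF r] by (simp add: s_def)
  have w_le: "(\<Sum>y\<in>D. w x y) \<le> \<pi> x" if "x \<in> D" for x using tot[OF that] b0[OF that] by linarith
  have "\<exists>u. \<forall>x\<in>D. 0 \<le> u x \<and> u x \<le> 1 \<and> u x = s * b x / \<pi> x + (\<Sum>y\<in>D. s * w x y / \<pi> x * u y)"
  proof (rule nonneg_linear_system_solution)
    fix x assume x: "x \<in> D"
    have "s * ((\<Sum>y\<in>D. w x y) + b x) \<le> 1 * \<pi> x"
      using s tot[OF x] b0[OF x] by (intro mult_mono add_nonneg_nonneg sum_nonneg w0) auto
    then have "s * ((\<Sum>y\<in>D. w x y) + b x) / \<pi> x \<le> 1"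
      using pi0[OF x] by (simp add: field_simps)
    then show "s * b x / \<pi> x + (\<Sum>y\<in>D. s * w x y / \<pi> x * 1) \<le> 1"
      by (simp add: distrib_left add_divide_distrib sum_distrib_left sum_divide_distrib)
  qed (use s w0 b0 pi0 in \<open>auto simp: less_imp_le\<close>)
  then obtain u where u: "\<And>x. x \<in> D \<Longrightarrow> 0 \<le> u x" "\<And>x. x \<in> D \<Longrightarrow> u x \<le> 1"
      "\<And>x. x \<in> D \<Longrightarrow> u x = s * b x / \<pi> x + (\<Sum>y\<in>D. s * w x y / \<pi> x * u y)" by blast
  have u_eq: "\<pi> x * u x = s * ((\<Sum>y\<in>D. w x y * u y) + b x)" if "x \<in> D" for x
  proof -
    have "\<pi> x * u x = \<pi> x * (s * b x / \<pi> x) + (\<Sum>y\<in>D. \<pi> x * (s * w x y / \<pi> x * u y))"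
      by (subst u(3)[OF that]) (simp add: distrib_left sum_distrib_left)
    also have "\<dots> = s * b x + (\<Sum>y\<in>D. s * (w x y * u y))"
      using pi0[OF that] by (simp add: mult.assoc)
    finally show ?thesis by (simp add: distrib_left sum_distrib_left)
  qed
  have "\<exists>v. \<forall>x\<in>D. 0 \<le> v x \<and> v x \<le> C \<and> v x = (if x = r then 1 else 0) / \<pi> x + (\<Sum>y\<in>D. s * w x y / \<pi> x * v y)"
  proof (rule nonneg_linear_system_solution)
    fix x assume x: "x \<in> D"
    have "(if x = r then 1 else 0) \<le> (1 - s) * \<pi> x * C"
    proof (cases "x = r")
      case True
      then show ?thesis using s pi0[OF x] by (simp add: C_def flip: s_def)
    next
      case False
      then show ?thesis using s pi0[OF x] C0 by simp
    qed
    moreover have "s * C * (\<Sum>y\<in>D. w x y) \<le> s * C * \<pi> x"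
      using s C0 w_le[OF x] by (intro mult_left_mono) auto
    ultimately have "(if x = r then 1 else 0) + s * C * (\<Sum>y\<in>D. w x y) \<le> \<pi> x * C"
      by (simp add: algebra_simps split: if_splits)
    then have "((if x = r then 1 else 0) + s * C * (\<Sum>y\<in>D. w x y)) / \<pi> x \<le> C"
      using pi0[OF x] by (simp add: field_simps)
    then show "(if x = r then 1 else 0) / \<pi> x + (\<Sum>y\<in>D. s * w x y / \<pi> x * C) \<le> C"
      by (simp add: add_divide_distrib sum_distrib_left sum_divide_distrib mult_ac)
  qed (use s w0 b0 pi0 C0 in \<open>auto simp: less_imp_le\<close>)
  then obtain v where v: "\<And>x. x \<in> D \<Longrightarrow> 0 \<le> v x" "\<And>x. x \<in> D \<Longrightarrow> v x \<le> C"
      "\<And>x. x \<in> D \<Longrightarrow> v x = (if x = r then 1 else 0) / \<pi> x + (\<Sum>y\<in>D. s * w x y / \<pi> x * v y)" by blast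
  have v_eq: "\<pi> x * v x = (if x = r then 1 else 0) + s * (\<Sum>y\<in>D. w x y * v y)" if "x \<in> D" for x
  proof -
    have "\<pi> x * v x = \<pi> x * ((if x = r then 1 else 0) / \<pi> x) + (\<Sum>y\<in>D. \<pi> x * (s * w x y / \<pi> x * v y))"
      by (subst v(3)[OF that]) (simp add: distrib_left sum_distrib_left)
    also have "\<dots> = (if x = r then 1 else 0) + (\<Sum>y\<in>D. s * (w x y * v y))"
      using pi0[OF that] by (simp add: mult.assoc)
    finally show ?thesis by (simp add: sum_distrib_left)
  qed
  have beta: "0 < \<beta>" using c by (simp add: \<beta>_def)
  have B: "0 < ?B" using beta t by (intro add_pos_pos mult_pos_pos) auto
  have "u r \<le> exp (- (?A / ?B))"
  proof (cases "u r = 0")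
    case False
    \<comment> \<open>The vertices that the conditioned walk can visit; \<open>E\<close> is a union of components of \<open>D\<close>.\<close>
    define E where "E = {x \<in> D. 0 < u x \<and> 0 < v x}"
    have ED: "E \<subseteq> D" by (auto simp: E_def)
    have E0: "w x y * u y = 0 \<and> w x y * v y = 0 \<and> w x y = 0" if "x \<in> E" "y \<in> D - E" for x y
    proof (cases "0 < w x y")
      case True
      have x: "x \<in> D" "0 < u x" "0 < v x" and y: "y \<in> D" using that by (auto simp: E_def)
      have "0 < w y x * u x" using True x by (simp add: sym[of y x])
      also have "\<dots> \<le> (\<Sum>z\<in>D. w y z * u z)"
        using fin x u(1) w0 by (intro member_le_sum) auto
      finally have "0 < \<pi> y * u y"
        unfolding u_eq[OF y] using s b0[OF y] by (intro mult_pos_pos add_pos_nonneg) auto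
      then have 1: "0 < u y" using pi0[OF y] by (simp add: zero_less_mult_iff)
      have "0 < w y x * v x" using True x by (simp add: sym[of y x])
      also have "\<dots> \<le> (\<Sum>z\<in>D. w y z * v z)"
        using fin x v(1) w0 by (intro member_le_sum) auto
      finally have "0 < \<pi> y * v y"
        unfolding v_eq[OF y] using s by (intro add_nonneg_pos mult_pos_pos) auto
      then have "0 < v y" using pi0[OF y] by (simp add: zero_less_mult_iff)
      with 1 that show ?thesis by (simp add: E_def)
    next
      case False
      then have "w x y = 0" using w0[of x y] by simp
      then show ?thesis by simp
    qed
    have sumE: "(\<Sum>y\<in>D. w x y * F y) = (\<Sum>y\<in>E. w x y * F y)" if "x \<in> E" for F x
      using ED fin E0[OF that] by (intro sum.mono_neutral_right) auto
    have "0 < \<pi> r * v r"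
      unfolding v_eq[OF r] using s w0 v(1) by (simp add: add_pos_nonneg sum_nonneg)
    then have "0 < v r" using pi0[OF r] by (simp add: zero_less_mult_iff)
    then have rE: "r \<in> E" using False u(1)[OF r] r by (auto simp: E_def)
    have "?A \<le> ?B * (- ln (u r))"
      unfolding \<beta>_def
    proof (rule positive_network_bound[where D = E and v = v and b = b and \<pi> = \<pi> and lev = lev and w = w])
      show "finite E" using fin ED by (rule rev_finite_subset)
      show "(\<Sum>y\<in>E. w x y) + b x \<le> \<pi> x" if "x \<in> E" for x
        using sumE[OF that, of "\<lambda>_. 1"] tot[of x] that ED by auto
      show "\<pi> x * u x = exp (- t) * ((\<Sum>y\<in>E. w x y * u y) + b x)" if "x \<in> E" for x
        using u_eq[of x] sumE[OF that, of u] that ED by (auto simp: s_def)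
      show "\<pi> x * v x = (if x = r then 1 else 0) + exp (- t) * (\<Sum>y\<in>E. w x y * v y)" if "x \<in> E" for x
        using v_eq[of x] sumE[OF that, of v] that ED by (auto simp: s_def)
      have "(\<Sum>x\<in>E. b x) \<le> (\<Sum>x\<in>D. b x)" using fin ED b0 by (intro sum_mono2) auto
      then show "(\<Sum>x\<in>E. b x) \<le> W" using W by simp
    qed (use rE ED sym w0 b0 lip lev t u(1,2) v(1,2) W c r in \<open>auto simp: E_def\<close>)
    then have "ln (u r) \<le> - (?A / ?B)" using B by (simp add: field_simps)
    then show ?thesis using False u(1)[OF r] by (metis exp_le_cancel_iff exp_ln order_le_less)
  qed simp
  then show ?thesis using u(1,2) u_eq s_def by blast
qed

section \<open>Markov property and exit probabilities of the walk\<close>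

locale weighted_walk =
  fixes w :: "'v \<Rightarrow> 'v \<Rightarrow> real" and r :: 'v and M :: "'a measure" and X :: "nat \<Rightarrow> 'a \<Rightarrow> 'v"
  assumes graph: "weighted_graph w" and walk: "random_walk w r M X"

sublocale weighted_walk \<subseteq> prob_space M
  using walk by (simp add: random_walk_def)

context weighted_walk
begin

lemma w_sym: "w x y = w y x" and w_nonneg: "0 \<le> w x y"
  and w_summable: "w x summable_on A" and vweight_pos: "0 < vweight w x"
proof -
  show "w x y = w y x" "0 \<le> w x y" "0 < vweight w x" using graph by (auto simp: weighted_graph_def)
  have "w x summable_on UNIV" using graph by (auto simp: weighted_graph_def)
  then show "w x summable_on A" by (rule summable_on_subset_banach) simp
qed

lemma X_measurable [measurable]: "X k \<in> measurable M (count_space UNIV)"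
  using walk by (simp add: random_walk_def)

lemma X_in_measurable [measurable]: "Measurable.pred M (\<lambda>\<omega>. X k \<omega> \<in> A)"
  by (rule measurable_compose[OF X_measurable]) simp

lemma X_eq_measurable [measurable]: "Measurable.pred M (\<lambda>\<omega>. X k \<omega> = x)"
  by (rule measurable_compose[OF X_measurable]) simp

definition step :: "'v \<Rightarrow> 'v set \<Rightarrow> real" where
  "step x Y = infsum (w x) Y / vweight w x"

lemma step_UNIV: "step x UNIV = 1"
  using vweight_pos[of x] by (simp add: step_def vweight_def)

lemma step_Compl: "step x (- Y) = 1 - step x Y"
proof -
  have "infsum (w x) (Y \<union> - Y) = infsum (w x) Y + infsum (w x) (- Y)"
    by (rule infsum_Un_disjoint) (auto intro: w_summable)
  then have "step x UNIV = step x Y + step x (- Y)"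
    by (simp add: step_def add_divide_distrib)
  then show ?thesis by (simp add: step_UNIV)
qed

text \<open>The set \<open>Y\<close> may be uncountable, so countable additivity does not apply to its points. Finite subsets
of \<open>Y\<close> give this lower bound; applied to \<open>Y\<close> and to its complement, it leaves no room for a strict
inequality, which is how \<open>cylinder_step\<close> follows.\<close>

lemma cylinder_step_ge:
  "prob {\<omega> \<in> space M. \<forall>i\<le>n. X i \<omega> = z i} * step (z n) Y
    \<le> prob {\<omega> \<in> space M. (\<forall>i\<le>n. X i \<omega> = z i) \<and> X (Suc n) \<omega> \<in> Y}" (is "?P * _ \<le> ?Q")
proof -
  let ?q = "\<lambda>y. w (z n) y * (?P / vweight w (z n))"
  have "infsum ?q Y \<le> ?Q"
  proof (rule infsum_le_finite_sums)
    show "?q summable_on Y" by (intro summable_on_cmult_left w_summable)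
    fix F assume F: "finite F" "F \<subseteq> Y"
    let ?A = "\<lambda>y. {\<omega> \<in> space M. \<forall>i\<le>Suc n. X i \<omega> = (z(Suc n := y)) i}"
    have A: "?A y = {\<omega> \<in> space M. (\<forall>i\<le>n. X i \<omega> = z i) \<and> X (Suc n) \<omega> = y}" for y
      by (auto simp: le_Suc_eq)
    have "prob (?A y) = ?q y" for y
    proof -
      have "prob (?A y) = prob {\<omega> \<in> space M. \<forall>i\<le>n. X i \<omega> = (z(Suc n := y)) i}
          * (w ((z(Suc n := y)) n) ((z(Suc n := y)) (Suc n)) / vweight w ((z(Suc n := y)) n))"
        using walk unfolding random_walk_def by blast
      also have "{\<omega> \<in> space M. \<forall>i\<le>n. X i \<omega> = (z(Suc n := y)) i} = {\<omega> \<in> space M. \<forall>i\<le>n. X i \<omega> = z i}"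
        by auto
      finally show ?thesis by simp
    qed
    then have "sum ?q F = (\<Sum>y\<in>F. prob (?A y))" by simp
    also have "\<dots> = prob (\<Union>y\<in>F. ?A y)"
      unfolding A using F
      by (intro finite_measure_finite_Union[symmetric]) (auto simp: disjoint_family_on_def)
    also have "\<dots> \<le> ?Q"
      unfolding A using F by (intro finite_measure_mono) auto
    finally show "sum ?q F \<le> ?Q" .
  qed
  moreover have "infsum ?q Y = infsum (w (z n)) Y * (?P / vweight w (z n))"
    by (rule infsum_cmult_left')
  ultimately show ?thesis by (simp add: step_def mult_ac)
qed

lemma cylinder_step:
  "prob {\<omega> \<in> space M. (\<forall>i\<le>n. X i \<omega> = z i) \<and> X (Suc n) \<omega> \<in> Y}
    = prob {\<omega> \<in> space M. \<forall>i\<le>n. X i \<omega> = z i} * step (z n) Y"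
proof -
  let ?Q = "\<lambda>Y. {\<omega> \<in> space M. (\<forall>i\<le>n. X i \<omega> = z i) \<and> X (Suc n) \<omega> \<in> Y}"
  have "prob (?Q Y \<union> ?Q (- Y)) = prob (?Q Y) + prob (?Q (- Y))"
    by (rule finite_measure_Union) auto
  moreover have "?Q Y \<union> ?Q (- Y) = {\<omega> \<in> space M. \<forall>i\<le>n. X i \<omega> = z i}" by auto
  ultimately show ?thesis
    using cylinder_step_ge[of n z Y] cylinder_step_ge[of n z "- Y"]
    by (simp add: step_Compl algebra_simps)
qed

text \<open>The history confined to the finite set \<open>D\<close> is a disjoint union of finitely many cylinders.\<close>

lemma markov_step:
  assumes "finite D"
  shows "prob {\<omega> \<in> space M. (\<forall>i\<le>n. X i \<omega> \<in> D) \<and> X n \<omega> = x \<and> X (Suc n) \<omega> \<in> Y}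
    = prob {\<omega> \<in> space M. (\<forall>i\<le>n. X i \<omega> \<in> D) \<and> X n \<omega> = x} * step x Y"
proof -
  define Z where "Z = {z \<in> {..n} \<rightarrow>\<^sub>E D. z n = x}"
  have fin: "finite Z" unfolding Z_def using assms by (simp add: finite_PiE)
  have split: "prob {\<omega> \<in> space M. (\<forall>i\<le>n. X i \<omega> \<in> D) \<and> X n \<omega> = x \<and> X (Suc n) \<omega> \<in> Y'}
      = (\<Sum>z\<in>Z. prob {\<omega> \<in> space M. (\<forall>i\<le>n. X i \<omega> = z i) \<and> X (Suc n) \<omega> \<in> Y'})"
    (is "prob ?L = (\<Sum>z\<in>Z. prob (?R z))") for Y'
  proof -
    have "?L = (\<Union>z\<in>Z. ?R z)"
    proof (intro set_eqI iffI)
      fix \<omega> assume "\<omega> \<in> ?L"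
      then have "restrict (\<lambda>i. X i \<omega>) {..n} \<in> Z" "\<omega> \<in> ?R (restrict (\<lambda>i. X i \<omega>) {..n})"
        by (auto simp: Z_def)
      then show "\<omega> \<in> (\<Union>z\<in>Z. ?R z)" by blast
    qed (auto simp: Z_def PiE_iff)
    moreover have "disjoint_family_on ?R Z"
    proof -
      have "z = z'" if "z \<in> Z" "z' \<in> Z" "\<omega> \<in> ?R z" "\<omega> \<in> ?R z'" for z z' \<omega>
        using that by (intro PiE_ext[of z "{..n}" "\<lambda>_. D" z']) (auto simp: Z_def)
      then show ?thesis unfolding disjoint_family_on_def by blast
    qed
    ultimately show ?thesis using fin by (simp add: finite_measure_finite_Union image_subset_iff)
  qed
  have "(\<Sum>z\<in>Z. prob {\<omega> \<in> space M. (\<forall>i\<le>n. X i \<omega> = z i) \<and> X (Suc n) \<omega> \<in> Y})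
      = (\<Sum>z\<in>Z. prob {\<omega> \<in> space M. \<forall>i\<le>n. X i \<omega> = z i}) * step x Y"
    unfolding cylinder_step sum_distrib_right by (intro sum.cong) (auto simp: Z_def)
  then show ?thesis using split[of Y] split[of UNIV] by simp
qed

lemma prob_split_last:
  assumes "finite D" and [measurable]: "Measurable.pred M R"
  shows "prob {\<omega> \<in> space M. (\<forall>i\<le>n. X i \<omega> \<in> D) \<and> R \<omega>}
    = (\<Sum>x\<in>D. prob {\<omega> \<in> space M. (\<forall>i\<le>n. X i \<omega> \<in> D) \<and> X n \<omega> = x \<and> R \<omega>})"
proof -
  let ?A = "\<lambda>x. {\<omega> \<in> space M. (\<forall>i\<le>n. X i \<omega> \<in> D) \<and> X n \<omega> = x \<and> R \<omega>}"
  have "{\<omega> \<in> space M. (\<forall>i\<le>n. X i \<omega> \<in> D) \<and> R \<omega>} = (\<Union>x\<in>D. ?A x)" by auto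
  also have "prob \<dots> = (\<Sum>x\<in>D. prob (?A x))"
    using assms(1) by (intro finite_measure_finite_Union) (auto simp: disjoint_family_on_def)
  finally show ?thesis .
qed

lemma prob_start: "prob {\<omega> \<in> space M. X 0 \<omega> = x} = (if x = r then 1 else 0)"
proof -
  have ae: "AE \<omega> in M. X 0 \<omega> = r" using walk by (simp add: random_walk_def)
  show ?thesis
  proof (cases "x = r")
    case True
    then show ?thesis using ae by (simp add: prob_Collect_eq_1)
  next
    case False
    then have "AE \<omega> in M. \<not> X 0 \<omega> = x" using ae by (auto elim: eventually_mono)
    then show ?thesis using False by (simp add: prob_Collect_eq_0)
  qed
qed

text \<open>The vertices may have infinitely many neighbours. Up to an arbitrarily small probability the walk
nevertheless stays in a finite set for any given time, and this is what reduces the problem to finite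
networks.\<close>

lemma walk_tight:
  assumes "0 < \<eta>"
  shows "\<exists>F. finite F \<and> 1 - \<eta> \<le> prob {\<omega> \<in> space M. \<forall>i\<le>n. X i \<omega> \<in> F}"
  using assms
proof (induction n arbitrary: \<eta>)
  case 0
  have "1 - \<eta> \<le> prob {\<omega> \<in> space M. \<forall>i\<le>0. X i \<omega> \<in> {r}}"
    using prob_start[of r] 0 by simp
  then show ?case by blast
next
  case (Suc n)
  have "0 < \<eta> / 2" using Suc.prems by simp
  from Suc.IH[OF this] obtain F where F: "finite F" "1 - \<eta> / 2 \<le> prob {\<omega> \<in> space M. \<forall>i\<le>n. X i \<omega> \<in> F}"
    by blast
  have "\<exists>G. finite G \<and> 1 - \<eta> / 2 \<le> step x G" for x
  proof -
    have "0 < \<eta> / 2 * vweight w x" using Suc.prems vweight_pos by simp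
    from infsum_finite_approximation[OF w_summable[of x UNIV] this]
    obtain G where G: "finite G" "dist (sum (w x) G) (vweight w x) \<le> \<eta> / 2 * vweight w x"
      by (auto simp: vweight_def)
    then have "vweight w x - \<eta> / 2 * vweight w x \<le> sum (w x) G"
      unfolding dist_real_def by linarith
    then have "1 - \<eta> / 2 \<le> step x G"
      using vweight_pos[of x] G(1) by (simp add: step_def field_simps)
    with G(1) show ?thesis by blast
  qed
  then obtain G where G: "\<And>x. finite (G x)" "\<And>x. 1 - \<eta> / 2 \<le> step x (G x)" by metis
  define H where "H = (\<Union>x\<in>F. G x)"
  have H: "finite H" unfolding H_def using F G by auto
  have stepH: "1 - \<eta> / 2 \<le> step x H" if "x \<in> F" for x
  proof -
    have "infsum (w x) (G x) \<le> infsum (w x) H"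
      using that by (intro infsum_mono2 w_summable w_nonneg) (auto simp: H_def)
    then have "step x (G x) \<le> step x H"
      unfolding step_def using vweight_pos[of x] by (simp add: divide_right_mono)
    with G(2)[of x] show ?thesis by linarith
  qed
  let ?p = "\<lambda>x. prob {\<omega> \<in> space M. (\<forall>i\<le>n. X i \<omega> \<in> F) \<and> X n \<omega> = x}"
  have S: "(\<Sum>x\<in>F. ?p x) = prob {\<omega> \<in> space M. \<forall>i\<le>n. X i \<omega> \<in> F}"
    using prob_split_last[OF F(1), of "\<lambda>_. True" n] by simp
  have "1 - \<eta> \<le> prob {\<omega> \<in> space M. \<forall>i\<le>n. X i \<omega> \<in> F} - \<eta> / 2" using F(2) by (simp add: field_simps)
  also have "\<dots> \<le> (1 - \<eta> / 2) * prob {\<omega> \<in> space M. \<forall>i\<le>n. X i \<omega> \<in> F}"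
    using Suc.prems prob_le_1[of "{\<omega> \<in> space M. \<forall>i\<le>n. X i \<omega> \<in> F}"]
    by (simp add: left_diff_distrib mult_left_le)
  also have "\<dots> = (\<Sum>x\<in>F. ?p x * (1 - \<eta> / 2))" by (simp flip: sum_distrib_right add: S)
  also have "\<dots> \<le> (\<Sum>x\<in>F. ?p x * step x H)"
    by (intro sum_mono mult_left_mono stepH measure_nonneg)
  also have "\<dots> = prob {\<omega> \<in> space M. (\<forall>i\<le>n. X i \<omega> \<in> F) \<and> X (Suc n) \<omega> \<in> H}"
    unfolding markov_step[OF F(1), symmetric] by (rule prob_split_last[symmetric, OF F(1)]) measurable
  also have "\<dots> \<le> prob {\<omega> \<in> space M. \<forall>i\<le>Suc n. X i \<omega> \<in> F \<union> H}"
    by (intro finite_measure_mono) (auto simp: le_Suc_eq)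
  finally show ?case using F(1) H by blast
qed

text \<open>Optional stopping for the martingale \<open>s ^ k * u (X k)\<close>, where \<open>u\<close> is extended by \<open>1\<close> on \<open>Z\<close> and by
\<open>0\<close> outside \<open>D\<close> and \<open>Z\<close>, and the walk is stopped on leaving \<open>D\<close>.\<close>

lemma exit_transform_identity:
  assumes D: "finite D" "r \<in> D" and s: "0 < s"
    and u: "\<And>x. x \<in> D \<Longrightarrow> vweight w x * u x = s * ((\<Sum>y\<in>D. w x y * u y) + infsum (w x) Z)"
  shows "(\<Sum>j<k. s ^ Suc j * prob {\<omega> \<in> space M. (\<forall>i\<le>j. X i \<omega> \<in> D) \<and> X (Suc j) \<omega> \<in> Z})
    + s ^ k * (\<Sum>x\<in>D. prob {\<omega> \<in> space M. (\<forall>i\<le>k. X i \<omega> \<in> D) \<and> X k \<omega> = x} * u x) = u r"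
proof (induction k)
  case 0
  have "prob {\<omega> \<in> space M. (\<forall>i\<le>0. X i \<omega> \<in> D) \<and> X 0 \<omega> = x} * u x = (if x = r then u r else 0)"
    if "x \<in> D" for x
  proof -
    have "{\<omega> \<in> space M. (\<forall>i\<le>0. X i \<omega> \<in> D) \<and> X 0 \<omega> = x} = {\<omega> \<in> space M. X 0 \<omega> = x}"
      using that by auto
    then show ?thesis by (simp add: prob_start)
  qed
  then show ?case using D by (simp cong: sum.cong)
next
  case (Suc k)
  let ?p = "\<lambda>k x. prob {\<omega> \<in> space M. (\<forall>i\<le>k. X i \<omega> \<in> D) \<and> X k \<omega> = x}"
  let ?e = "prob {\<omega> \<in> space M. (\<forall>i\<le>k. X i \<omega> \<in> D) \<and> X (Suc k) \<omega> \<in> Z}"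
  have e: "?e = (\<Sum>x\<in>D. ?p k x * step x Z)"
    unfolding markov_step[OF D(1), symmetric] by (rule prob_split_last[OF D(1)]) measurable
  have p: "?p (Suc k) y = (\<Sum>x\<in>D. ?p k x * (w x y / vweight w x))" if "y \<in> D" for y
  proof -
    have "{\<omega> \<in> space M. (\<forall>i\<le>Suc k. X i \<omega> \<in> D) \<and> X (Suc k) \<omega> = y}
        = {\<omega> \<in> space M. (\<forall>i\<le>k. X i \<omega> \<in> D) \<and> X (Suc k) \<omega> \<in> {y}}"
      using that by (auto simp: le_Suc_eq)
    also have "prob \<dots> = (\<Sum>x\<in>D. ?p k x * step x {y})"
      unfolding markov_step[OF D(1), symmetric] by (rule prob_split_last[OF D(1)]) measurable
    finally show ?thesis by (simp add: step_def)
  qed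
  have "s * (?e + (\<Sum>y\<in>D. ?p (Suc k) y * u y)) = (\<Sum>x\<in>D. ?p k x * u x)"
  proof -
    have "(\<Sum>y\<in>D. ?p (Suc k) y * u y) = (\<Sum>y\<in>D. \<Sum>x\<in>D. ?p k x * (w x y / vweight w x) * u y)"
      by (intro sum.cong refl) (simp add: p sum_distrib_right)
    also have "\<dots> = (\<Sum>x\<in>D. \<Sum>y\<in>D. ?p k x * (w x y / vweight w x) * u y)" by (rule sum.swap)
    also have "\<dots> = (\<Sum>x\<in>D. ?p k x * ((\<Sum>y\<in>D. w x y * u y) / vweight w x))"
      by (simp add: sum_distrib_left sum_distrib_right sum_divide_distrib mult_ac)
    finally have u_next: "(\<Sum>y\<in>D. ?p (Suc k) y * u y)
        = (\<Sum>x\<in>D. ?p k x * ((\<Sum>y\<in>D. w x y * u y) / vweight w x))" .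
    have "s * (?e + (\<Sum>y\<in>D. ?p (Suc k) y * u y))
        = (\<Sum>x\<in>D. ?p k x * (s * ((\<Sum>y\<in>D. w x y * u y) + infsum (w x) Z) / vweight w x))"
    proof -
      have "s * (a * (z / v) + a * (b / v)) = a * (s * (b + z) / v)" for a b z v :: real
        by (cases "v = 0") (simp_all add: field_simps)
      then show ?thesis
        unfolding e u_next step_def sum.distrib[symmetric] by (subst sum_distrib_left) (simp only:)
    qed
    also have "\<dots> = (\<Sum>x\<in>D. ?p k x * u x)"
    proof (intro sum.cong refl)
      fix x assume "x \<in> D"
      from u[OF this, symmetric] have
        "s * ((\<Sum>y\<in>D. w x y * u y) + infsum (w x) Z) / vweight w x = u x"
        using vweight_pos[of x] by simp
      then show "?p k x * (s * ((\<Sum>y\<in>D. w x y * u y) + infsum (w x) Z) / vweight w x) = ?p k x * u x"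
        by (simp only:)
    qed
    finally show ?thesis .
  qed
  then have "s ^ k * (s * (?e + (\<Sum>y\<in>D. ?p (Suc k) y * u y))) = s ^ k * (\<Sum>x\<in>D. ?p k x * u x)"
    by (simp only:)
  then show ?case unfolding Suc[symmetric] sum.lessThan_Suc power_Suc2 distrib_left
    by (simp only: mult.assoc)
qed

text \<open>A walk that is in \<open>Z\<close> at time \<open>k\<close> has entered \<open>Z\<close> by then, and the transform \<open>u r\<close> counts this event
with a weight of at least \<open>s ^ k\<close>. The finite sets \<open>D\<close> supplied by \<open>walk_tight\<close> are not fixed in
advance, so the bound \<open>B\<close> has to be uniform in \<open>D\<close>.\<close>

lemma prob_in_target_le:
  assumes r: "r \<notin> Z" and s: "0 < s" "s \<le> 1"
    and u: "\<And>D. finite D \<Longrightarrow> r \<in> D \<Longrightarrow> D \<inter> Z = {} \<Longrightarrow>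
      \<exists>u. (\<forall>x\<in>D. 0 \<le> u x \<and> vweight w x * u x = s * ((\<Sum>y\<in>D. w x y * u y) + infsum (w x) Z)) \<and> u r \<le> B"
  shows "prob {\<omega> \<in> space M. X k \<omega> \<in> Z} \<le> B / s ^ k"
proof (rule field_le_epsilon)
  fix \<eta> :: real assume "0 < \<eta>"
  then obtain F where F: "finite F" "1 - \<eta> \<le> prob {\<omega> \<in> space M. \<forall>i\<le>k. X i \<omega> \<in> F}"
    using walk_tight by blast
  define D where "D = insert r (F - Z)"
  have D: "finite D" "r \<in> D" "D \<inter> Z = {}" using F r by (auto simp: D_def)
  obtain u where u0: "\<And>x. x \<in> D \<Longrightarrow> 0 \<le> u x"
    and u_eq: "\<And>x. x \<in> D \<Longrightarrow> vweight w x * u x = s * ((\<Sum>y\<in>D. w x y * u y) + infsum (w x) Z)"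
    and uB: "u r \<le> B"
    using u[OF D] by blast
  let ?E = "\<lambda>j. {\<omega> \<in> space M. (\<forall>i\<le>j. X i \<omega> \<in> D) \<and> X (Suc j) \<omega> \<in> Z}"
  let ?G = "{\<omega> \<in> space M. \<not> (\<forall>i\<le>k. X i \<omega> \<in> F)}"
  have G: "prob ?G \<le> \<eta>"
    using F(2) prob_neg[of "\<lambda>\<omega>. \<forall>i\<le>k. X i \<omega> \<in> F"] by simp
  have "s ^ k * (\<Sum>j<k. prob (?E j)) \<le> (\<Sum>j<k. s ^ Suc j * prob (?E j))"
    unfolding sum_distrib_left using s
    by (intro sum_mono mult_right_mono power_decreasing) auto
  also have "\<dots> \<le> u r"
    using exit_transform_identity[where D = D and u = u and Z = Z and k = k and s = s, OF D(1,2) s(1) u_eq, symmetric]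
    by (simp add: sum_nonneg u0 s less_imp_le)
  finally have E: "(\<Sum>j<k. prob (?E j)) \<le> B / s ^ k"
    using uB s by (simp add: pos_le_divide_eq mult.commute)
  have "AE \<omega> in M. X 0 \<omega> = r" using walk by (simp add: random_walk_def)
  then have "AE \<omega> in M. \<omega> \<in> {\<omega> \<in> space M. X k \<omega> \<in> Z} \<longrightarrow> \<omega> \<in> (\<Union>j<k. ?E j) \<union> ?G"
  proof eventually_elim
    case (elim \<omega>)
    show ?case
    proof (intro impI)
      assume \<omega>: "\<omega> \<in> {\<omega> \<in> space M. X k \<omega> \<in> Z}"
      show "\<omega> \<in> (\<Union>j<k. ?E j) \<union> ?G"
      proof (cases "\<forall>i\<le>k. X i \<omega> \<in> F")
        case True
        define l where "l = (LEAST j. X j \<omega> \<in> Z)"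
        have "X k \<omega> \<in> Z" using \<omega> by simp
        then have l: "X l \<omega> \<in> Z" "l \<le> k" unfolding l_def by (rule LeastI, rule Least_le)
        have before: "X i \<omega> \<notin> Z" if "i < l" for i using that not_less_Least unfolding l_def by blast
        obtain j where j: "l = Suc j" using l(1) elim r by (cases l) auto
        have "\<forall>i\<le>j. X i \<omega> \<in> D" using True before l(2) j by (auto simp: D_def)
        then show ?thesis using l j \<omega> by auto
      qed (use \<omega> in auto)
    qed
  qed
  then have "prob {\<omega> \<in> space M. X k \<omega> \<in> Z} \<le> prob ((\<Union>j<k. ?E j) \<union> ?G)"
    by (rule finite_measure_mono_AE) measurable
  also have "\<dots> \<le> prob (\<Union>j<k. ?E j) + prob ?G"
    by (rule measure_Un_le) measurable
  also have "prob (\<Union>j<k. ?E j) \<le> (\<Sum>j<k. prob (?E j))"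
    by (rule finite_measure_subadditive_finite) auto
  finally show "prob {\<omega> \<in> space M. X k \<omega> \<in> Z} \<le> B / s ^ k + \<eta>" using E G by linarith
qed

end

section \<open>Distances and level weights\<close>

lemma gdist_le: "(x, y) \<in> adj w ^^ n \<Longrightarrow> gdist w x y \<le> enat n"
  unfolding gdist_def by (rule INF_lower) simp

lemma gdist_eq_enatD:
  assumes "gdist w x y = enat n"
  shows "(x, y) \<in> adj w ^^ n"
proof -
  let ?N = "{n. (x, y) \<in> adj w ^^ n}"
  have "?N \<noteq> {}"
  proof
    assume "?N = {}"
    then have "gdist w x y = \<infinity>" unfolding gdist_def by (simp add: top_enat_def)
    with assms show False by simp
  qed
  then have "Inf (enat ` ?N) \<in> enat ` ?N"
    unfolding Inf_enat_def by (auto intro: LeastI)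
  then show ?thesis using assms by (auto simp: gdist_def)
qed

lemma gdist_self: "gdist w x x = 0"
  using gdist_le[where n = 0 and x = x and y = x and w = w] by (simp add: zero_enat_def[symmetric])

lemma gdist_edge_le:
  assumes "0 < w x y"
  shows "gdist w r y \<le> gdist w r x + 1"
proof (cases "gdist w r x")
  case (enat n)
  then have "(r, x) \<in> adj w ^^ n" by (rule gdist_eq_enatD)
  then have "(r, y) \<in> adj w ^^ Suc n" using assms by (auto simp: adj_def)
  from gdist_le[OF this] show ?thesis by (simp add: enat one_enat_def)
qed simp

lemma has_sum_finite_sum:
  fixes f :: "'i \<Rightarrow> 'v \<Rightarrow> real"
  assumes "finite I" "\<And>i. i \<in> I \<Longrightarrow> (f i has_sum S i) A"
  shows "((\<lambda>x. \<Sum>i\<in>I. f i x) has_sum (\<Sum>i\<in>I. S i)) A"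
  using assms by (induction I rule: finite_induct) (auto intro: has_sum_add)

text \<open>An edge from distance at most \<open>m\<close> to distance at least \<open>m + 1\<close> has its nearer endpoint at distance
exactly \<open>m\<close>. Its endpoints are told apart by their distances, so that distinct pairs \<open>(x, y)\<close> give distinct
edges of level \<open>m\<close>.\<close>

lemma boundary_weight_le:
  assumes graph: "weighted_graph w" and lw: "level_weight w r m \<le> ennreal L" and L: "0 \<le> L"
    and D: "finite D" "\<And>x. x \<in> D \<Longrightarrow> gdist w r x < enat (Suc m)"
    and Z: "\<And>y. y \<in> Z \<Longrightarrow> enat (Suc m) \<le> gdist w r y"
  shows "(\<Sum>x\<in>D. infsum (w x) Z) \<le> L"
proof -
  have w0: "0 \<le> w x y" and sym: "w x y = w y x" for x y using graph by (auto simp: weighted_graph_def)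
  have summ: "w x summable_on Z" for x
  proof -
    have "w x summable_on UNIV" using graph by (auto simp: weighted_graph_def)
    then show ?thesis by (rule summable_on_subset_banach) simp
  qed
  have "((\<lambda>y. \<Sum>x\<in>D. w x y) has_sum (\<Sum>x\<in>D. infsum (w x) Z)) Z"
    using D(1) summ by (intro has_sum_finite_sum) auto
  then show ?thesis
  proof (rule has_sum_le_finite_sums)
    fix G assume G: "finite G" "G \<subseteq> Z"
    define E where "E = {(x, y) \<in> D \<times> G. 0 < w x y}"
    have E: "finite E" unfolding E_def using D G by (auto intro: finite_subset[of _ "D \<times> G"])
    let ?e = "\<lambda>(x, y). {x, y}"
    have inj: "inj_on ?e E"
    proof (rule inj_onI)
      fix p q assume pq: "p \<in> E" "q \<in> E" "?e p = ?e q"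
      obtain x y x' y' where xy: "p = (x, y)" "q = (x', y')" by (cases p, cases q) auto
      have "x \<noteq> y'" "x' \<noteq> y"
        using pq xy D(2)[of x] D(2)[of x'] Z[of y] Z[of y'] G(2) by (auto simp: E_def)
      then show "p = q" using pq(3) xy by (auto simp: doubleton_eq_iff)
    qed
    have level: "{x, y} \<in> edges_at w r m" if "(x, y) \<in> E" for x y
    proof -
      have x: "gdist w r x < enat (Suc m)" and y: "enat (Suc m) \<le> gdist w r y" and p: "0 < w x y"
        using that D(2) Z G(2) by (auto simp: E_def)
      obtain n where n: "gdist w r x = enat n" using x by (cases "gdist w r x") auto
      have "enat (Suc m) \<le> enat n + 1" using y gdist_edge_le[of w x y r] p n by (metis order_trans)
      then have "n = m" using x n by (simp add: one_enat_def)
      then have "min (gdist w r x) (gdist w r y) = enat m"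
        using n y by (metis Suc_n_not_le_n enat_ord_simps(1) linorder_le_cases min.absorb1 order_trans)
      then show ?thesis unfolding edges_at_def using p by blast
    qed
    have "ennreal (\<Sum>y\<in>G. \<Sum>x\<in>D. w x y) = ennreal (\<Sum>(x, y)\<in>D \<times> G. w x y)"
      by (subst sum.swap) (simp add: sum.cartesian_product)
    also have "(\<Sum>(x, y)\<in>D \<times> G. w x y) = (\<Sum>(x, y)\<in>E. w x y)"
      using D(1) G(1) w0 by (intro sum.mono_neutral_right) (auto simp: E_def less_le)
    also have "(\<Sum>(x, y)\<in>E. w x y) = (\<Sum>e\<in>?e ` E. edge_weight w e)"
      by (subst sum.reindex[OF inj]) (auto simp: edge_weight_eq[OF graph] intro!: sum.cong)
    also have "ennreal \<dots> = (\<Sum>e\<in>?e ` E. ennreal (edge_weight w e))"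
      by (rule sum_ennreal[symmetric]) (auto simp: edge_weight_eq[OF graph] w0)
    also have "\<dots> = (\<Sum>\<^sub>\<infinity>e\<in>?e ` E. ennreal (edge_weight w e))"
      using E by simp
    also have "\<dots> \<le> level_weight w r m"
      unfolding level_weight_def using level
      by (intro infsum_mono_neutral nonneg_summable_on_complete) auto
    also note lw
    finally show "(\<Sum>y\<in>G. \<Sum>x\<in>D. w x y) \<le> L" using L by simp
  qed
qed

lemma level_weight_eventually_le:
  assumes c: "0 < c" "upper_growth w r < ennreal c"
  shows "eventually (\<lambda>m. level_weight w r m \<le> ennreal (c ^ m)) sequentially"
proof -
  have "eventually (\<lambda>m. ennroot m (level_weight w r m) < ennreal c) sequentially"
    using c(2) unfolding upper_growth_def by (rule Limsup_lessD)
  then show ?thesis using eventually_gt_at_top[of 0]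
  proof eventually_elim
    case (elim m)
    have fin: "level_weight w r m \<noteq> \<infinity>"
    proof
      assume "level_weight w r m = \<infinity>"
      with elim(1) show False by (simp add: ennroot_def)
    qed
    define a where "a = enn2real (level_weight w r m)"
    have a: "level_weight w r m = ennreal a" "0 \<le> a" using fin by (auto simp: a_def less_top)
    have root_nonneg: "0 \<le> root m a" using a(2) elim by simp
    have "root m a < c"
      using elim(1) fin ennreal_less_iff[OF root_nonneg] by (simp add: ennroot_def a_def)
    with root_nonneg have "root m a ^ m \<le> c ^ m" by (intro power_mono) auto
    then show ?case using a elim(2) by (simp add: ennreal_leI)
  qed
qed

section \<open>Large deviations and the speed\<close>

context weighted_walk
begin

text \<open>The bound \<open>hitting_transform_bound\<close> is used for finite subsets of the ball of radius \<open>m\<close>, with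
\<open>W = c ^ m\<close> and with the base \<open>c\<close> of the growth also as the point of tangency. Then the term \<open>\<beta> * ln W\<close> cancels
\<open>m * \<beta> * ln c\<close>, and the rate per level is \<open>(c + 1) / (c - 1)\<close>, the reciprocal of the speed on a
tree with branching number \<open>c\<close>.\<close>

lemma prob_far_le:
  assumes lw: "level_weight w r m \<le> ennreal (c ^ m)" and c: "1 < c" and t: "0 < t"
  defines "\<beta> \<equiv> 2 * c / (c - 1)^2" and "C \<equiv> 1 / ((1 - exp (-t)) * vweight w r)"
  shows "prob {\<omega> \<in> space M. enat (Suc m) \<le> gdist w r (X k \<omega>)}
    \<le> exp (t * real k - t * (real m * ((c + 1) / (c - 1)) - \<beta> * ln C) / (1 + 2 * \<beta> * t))"
proof -
  define Z where "Z = {y. enat (Suc m) \<le> gdist w r y}"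
  define lev where "lev x = real (the_enat (gdist w r x))" for x
  define B where "B = exp (- (t * (real m * ((c + 1) / (c - 1)) - \<beta> * ln C)) / (1 + 2 * \<beta> * t))"
  have "prob {\<omega> \<in> space M. X k \<omega> \<in> Z} \<le> B / exp (-t) ^ k"
  proof (rule prob_in_target_le)
    show "r \<notin> Z" by (simp add: Z_def gdist_self zero_enat_def)
    fix D assume D: "finite D" "r \<in> D" "D \<inter> Z = {}"
    have near: "gdist w r x < enat (Suc m)" if "x \<in> D" for x using that D(3) by (auto simp: Z_def)
    have lev: "gdist w r x = enat (the_enat (gdist w r x))" if "x \<in> D" for x
      using near[OF that] by (cases "gdist w r x") auto
    have lip1: "lev y \<le> lev x + 1" if "x \<in> D" "y \<in> D" "0 < w x y" for x y
    proof -
      have "enat (the_enat (gdist w r y)) \<le> enat (the_enat (gdist w r x)) + 1"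
        using gdist_edge_le[of w x y r] that lev by metis
      then show ?thesis by (simp add: lev_def one_enat_def)
    qed
    have "\<exists>u. (\<forall>x\<in>D. 0 \<le> u x \<and> u x \<le> 1 \<and>
        vweight w x * u x = exp (-t) * ((\<Sum>y\<in>D. w x y * u y) + infsum (w x) Z)) \<and>
      u r \<le> exp (- (t * (real m * ((c + 1) / (c - 1) + \<beta> * ln c) - \<beta> * (ln (c ^ m) + ln C))
        / (1 + 2 * \<beta> * t)))"
      unfolding \<beta>_def C_def
    proof (rule hitting_transform_bound[where lev = lev and w = w and D = D and \<pi> = "vweight w"])
      show "(\<Sum>y\<in>D. w x y) + infsum (w x) Z \<le> vweight w x" for x
      proof -
        have "infsum (w x) (D \<union> Z) = infsum (w x) D + infsum (w x) Z"
          using D(3) by (intro infsum_Un_disjoint w_summable) auto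
        moreover have "infsum (w x) (D \<union> Z) \<le> vweight w x"
          unfolding vweight_def by (intro infsum_mono2 w_summable w_nonneg) auto
        ultimately show ?thesis using D(1) by simp
      qed
      show "\<bar>lev x - lev y\<bar> \<le> 1" if "x \<in> D" "y \<in> D" "0 < w x y" for x y
        using lip1[of x y] lip1[of y x] that by (simp add: w_sym[of y x])
      show "lev r = 0" by (simp add: lev_def gdist_self zero_enat_def)
      show "real m \<le> lev x" if "x \<in> D" "0 < infsum (w x) Z" for x
      proof -
        have "\<exists>y\<in>Z. w x y \<noteq> 0"
        proof (rule ccontr)
          assume "\<not> ?thesis"
          then have "infsum (w x) Z = 0" by (intro infsum_0) auto
          with that show False by simp
        qed
        then obtain y where y: "y \<in> Z" "0 < w x y" using w_nonneg[of x] by (metis order_le_less)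
        have "enat (Suc m) \<le> enat (the_enat (gdist w r x)) + 1"
          using gdist_edge_le[of w x y r] y lev[OF that(1)] by (auto simp: Z_def intro: order_trans)
        then show ?thesis by (simp add: lev_def one_enat_def)
      qed
      show "(\<Sum>x\<in>D. infsum (w x) Z) \<le> c ^ m"
        using c near by (intro boundary_weight_le[OF graph lw _ D(1)]) (auto simp: Z_def)
    qed (use c t D w_sym w_nonneg vweight_pos in \<open>auto intro: infsum_nonneg\<close>)
    moreover have "real m * ((c + 1) / (c - 1) + \<beta> * ln c) - \<beta> * (ln (c ^ m) + ln C)
        = real m * ((c + 1) / (c - 1)) - \<beta> * ln C"
      using c by (simp add: ln_realpow algebra_simps)
    ultimately show "\<exists>u. (\<forall>x\<in>D. 0 \<le> u x \<and> vweight w x * u x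
        = exp (-t) * ((\<Sum>y\<in>D. w x y * u y) + infsum (w x) Z)) \<and> u r \<le> B"
      unfolding B_def by auto
  qed (use t in auto)
  also have "B / exp (-t) ^ k = exp (t * real k - t * (real m * ((c + 1) / (c - 1)) - \<beta> * ln C) / (1 + 2 * \<beta> * t))"
    unfolding B_def by (simp add: exp_of_nat_mult[symmetric] exp_diff[symmetric] mult.commute)
  finally show ?thesis by (simp add: Z_def)
qed

text \<open>At distance \<open>a * k\<close> and time \<open>k\<close> the exponent of \<open>prob_far_le\<close> is, up to a constant,
\<open>t * k * (1 - a * h / (1 + 2 * \<beta> * t))\<close> with \<open>h = (c + 1) / (c - 1)\<close>. As \<open>a * h > 1\<close>, it is
negative and linear in \<open>k\<close> for small \<open>t\<close>, and the Borel--Cantelli lemma applies.\<close>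

lemma AE_eventually_slow:
  assumes c: "1 < c" "upper_growth w r < ennreal c" and a: "(c - 1) / (c + 1) < a"
  shows "AE \<omega> in M. eventually (\<lambda>k. gdist w r (X k \<omega>) < enat (nat \<lceil>a * real k\<rceil>)) sequentially"
proof -
  define h where "h = (c + 1) / (c - 1)"
  define \<beta> where "\<beta> = 2 * c / (c - 1)^2"
  \<comment> \<open>This choice puts \<open>1 + 2 * \<beta> * t\<close> halfway between \<open>1\<close> and \<open>h * a\<close>.\<close>
  define t where "t = (h * a - 1) / (4 * \<beta>)"
  define C where "C = 1 / ((1 - exp (-t)) * vweight w r)"
  define \<tau> where "\<tau> = t / (1 + 2 * \<beta> * t)"
  have beta: "0 < \<beta>" using c by (simp add: \<beta>_def)
  have h: "0 < h" using c by (simp add: h_def)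
  have a0: "0 < a" using c a by (smt (verit) divide_nonneg_nonneg)
  have ha: "1 < h * a" using a c by (simp add: h_def field_simps)
  have t: "0 < t" using ha beta by (simp add: t_def)
  have bt: "2 * \<beta> * t = (h * a - 1) / 2" using beta by (simp add: t_def)
  have den: "0 < 1 + 2 * \<beta> * t" "1 + 2 * \<beta> * t < h * a" unfolding bt using ha by (auto simp: field_simps)
  have tau: "0 < \<tau>" using t den by (simp add: \<tau>_def)
  have rate: "t < \<tau> * h * a"
  proof -
    have "t * (1 + 2 * \<beta> * t) < t * (h * a)" using den t by (intro mult_strict_left_mono)
    then show ?thesis using den by (simp add: \<tau>_def pos_less_divide_eq mult_ac)
  qed
  define q where "q = exp (t - \<tau> * h * a)"
  have q: "0 < q" "q < 1" using rate by (auto simp: q_def)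
  define A where "A k = {\<omega> \<in> space M. enat (nat \<lceil>a * real k\<rceil>) \<le> gdist w r (X k \<omega>)}" for k
  have A_sets: "A k \<in> sets M" for k
  proof -
    have "A k = {\<omega> \<in> space M. X k \<omega> \<in> {y. enat (nat \<lceil>a * real k\<rceil>) \<le> gdist w r y}}"
      by (auto simp: A_def)
    also have "\<dots> \<in> sets M" by measurable
    finally show ?thesis .
  qed
  have "filterlim (\<lambda>k. nat \<lceil>a * real k\<rceil> - 1) at_top sequentially"
    unfolding filterlim_at_top
  proof
    fix N
    obtain K :: nat where K: "real (N + 1) / a < real K" using reals_Archimedean2 by blast
    have "N \<le> nat \<lceil>a * real k\<rceil> - 1" if "K \<le> k" for k
    proof -
      have "real (N + 1) < a * real K" using K a0 by (simp add: field_simps)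
      also have "\<dots> \<le> a * real k" using that a0 by simp
      finally have "int (N + 1) \<le> \<lceil>a * real k\<rceil>" by linarith
      then show ?thesis by linarith
    qed
    then show "eventually (\<lambda>k. N \<le> nat \<lceil>a * real k\<rceil> - 1) sequentially"
      unfolding eventually_sequentially by blast
  qed
  then have "eventually (\<lambda>k. level_weight w r (nat \<lceil>a * real k\<rceil> - 1)
      \<le> ennreal (c ^ (nat \<lceil>a * real k\<rceil> - 1))) sequentially"
    using c by (intro eventually_compose_filterlim[OF level_weight_eventually_le[of c w r]]) simp_all
  then have bound: "eventually (\<lambda>k. norm (prob (A k)) \<le> exp (\<tau> * (h + \<beta> * ln C)) * q ^ k) sequentially"
    using eventually_gt_at_top[of 0]
  proof eventually_elim
    case (elim k)
    define m where "m = nat \<lceil>a * real k\<rceil> - 1"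
    have "0 < a * real k" using a0 elim by simp
    then have m: "Suc m = nat \<lceil>a * real k\<rceil>" unfolding m_def by linarith
    then have m_ge: "a * real k - 1 \<le> real m" by linarith
    have "prob (A k) \<le> exp (t * real k - t * (real m * h - \<beta> * ln C) / (1 + 2 * \<beta> * t))"
      using prob_far_le[of m c t k] elim c t by (simp add: A_def m[symmetric] h_def \<beta>_def C_def)
    also have "t * (real m * h - \<beta> * ln C) / (1 + 2 * \<beta> * t) = \<tau> * (real m * h - \<beta> * ln C)"
      by (simp add: \<tau>_def)
    also have "t * real k - \<dots> \<le> \<tau> * (h + \<beta> * ln C) + real k * (t - \<tau> * h * a)"
    proof -
      have "\<tau> * (h * (a * real k - 1)) \<le> \<tau> * (h * real m)"
        using tau h m_ge by (intro mult_left_mono) auto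
      then show ?thesis by (simp add: algebra_simps)
    qed
    finally show ?case by (simp add: q_def exp_add exp_of_nat_mult)
  qed
  have "summable (\<lambda>k. exp (\<tau> * (h + \<beta> * ln C)) * q ^ k)"
    using q by (intro summable_mult summable_geometric) auto
  with bound have "summable (\<lambda>k. prob (A k))" by (rule summable_comparison_test_ev)
  then have "AE \<omega> in M. eventually (\<lambda>k. \<omega> \<in> space M - A k) sequentially"
    using A_sets by (intro borel_cantelli_AE1) (auto simp: less_top[symmetric])
  then show ?thesis
  proof eventually_elim
    case (elim \<omega>)
    then show ?case by (rule eventually_mono) (auto simp: A_def not_le)
  qed
qed

end

lemma speed_threshold_continuous:
  fixes g a :: real
  assumes "1 \<le> g" "(g - 1) / (g + 1) < a"
  shows "\<exists>c>g. (c - 1) / (c + 1) < a"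
proof -
  define \<delta> where "\<delta> = a * (g + 1) - (g - 1)"
  have \<delta>: "0 < \<delta>" using assms by (simp add: \<delta>_def pos_divide_less_eq)
  have a: "0 < a" using assms by (smt (verit) divide_nonneg_nonneg)
  have "0 < a * \<delta>" using a \<delta> by simp
  moreover have "a * (g + \<delta> / 2 + 1) = g - 1 + \<delta> + a * \<delta> / 2"
    by (simp add: \<delta>_def algebra_simps)
  ultimately have "g + \<delta> / 2 - 1 < a * (g + \<delta> / 2 + 1)" using \<delta> by linarith
  then have "(g + \<delta> / 2 - 1) / (g + \<delta> / 2 + 1) < a"
    using assms \<delta> by (simp add: pos_divide_less_eq)
  then show ?thesis using \<delta> by (intro exI[of _ "g + \<delta> / 2"]) auto
qed

theorem corollary5:
  fixes w :: "'v \<Rightarrow> 'v \<Rightarrow> real" and r :: 'v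
    and M :: "'a measure" and X :: "nat \<Rightarrow> 'a \<Rightarrow> 'v" and g :: real
  assumes "weighted_graph w"
    and "infinite (UNIV :: 'v set)"
    and "upper_growth w r < \<infinity>"
    and "g = max (enn2real (upper_growth w r)) 1"
    and "random_walk w r M X"
  shows "AE \<omega> in M. limsup (\<lambda>k. ereal_of_enat (gdist w r (X k \<omega>)) / ereal (real k))
           \<le> ereal ((g - 1) / (g + 1))"
proof -
  interpret weighted_walk w r M X
    using assms by unfold_locales
  define L where "L = (g - 1) / (g + 1)"
  have g: "1 \<le> g" using assms(4) by simp
  have ug: "upper_growth w r = ennreal (enn2real (upper_growth w r))"
    using assms(3) by (simp add: less_top)
  have slow: "AE \<omega> in M. limsup (\<lambda>k. ereal_of_enat (gdist w r (X k \<omega>)) / ereal (real k)) \<le> ereal a"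
    if a: "L < a" for a
  proof -
    obtain c where c: "g < c" "(c - 1) / (c + 1) < a"
      using speed_threshold_continuous[OF g] a unfolding L_def by blast
    have "enn2real (upper_growth w r) < c" using c(1) assms(4) by simp
    then have "upper_growth w r < ennreal c" by (subst ug) (simp add: ennreal_less_iff)
    from AE_eventually_slow[OF _ this c(2)] c(1) g
    have "AE \<omega> in M. eventually (\<lambda>k. gdist w r (X k \<omega>) < enat (nat \<lceil>a * real k\<rceil>)) sequentially"
      by simp
    then show ?thesis
    proof eventually_elim
      case (elim \<omega>)
      from elim eventually_gt_at_top[of 0]
      have "eventually (\<lambda>k. ereal_of_enat (gdist w r (X k \<omega>)) / ereal (real k) \<le> ereal a) sequentially"
      proof eventually_elim
        case (elim k)
        then obtain n where n: "gdist w r (X k \<omega>) = enat n" by (cases "gdist w r (X k \<omega>)") auto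
        with elim have "real n \<le> a * real k" by (simp, linarith)
        then show ?case using elim n by (simp add: field_simps)
      qed
      then show ?case by (rule Limsup_bounded)
    qed
  qed
  have "AE \<omega> in M. \<forall>n::nat. limsup (\<lambda>k. ereal_of_enat (gdist w r (X k \<omega>)) / ereal (real k))
      \<le> ereal (L + 1 / real (Suc n))"
    unfolding AE_all_countable by (intro allI slow) simp
  then show ?thesis
  proof eventually_elim
    case (elim \<omega>)
    have "(\<lambda>n. ereal (L + 1 / real (Suc n))) \<longlonglongrightarrow> ereal (L + 0)"
      by (intro tendsto_intros LIMSEQ_Suc[OF lim_1_over_n])
    then have "limsup (\<lambda>k. ereal_of_enat (gdist w r (X k \<omega>)) / ereal (real k)) \<le> ereal (L + 0)"
      by (rule LIMSEQ_le_const) (use elim in auto)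
    then show ?case by (simp add: L_def)
  qed
qed

end
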